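(* Let $n\ge2$. Suppose that for every $p\in\mathbb{N}$, every $K\in\mathcal{K}(\mathbb{R}^n)$ with $\dim(K)=n$ and every $t\in[0,1]$ one has $$\frac{|D_p^tK|}{|K|^p}\leq\frac{|D_p^tS_n|}{|S_n|^p},$$ where $S_n\in\mathcal{K}(\mathbb{R}^n)$ is an $n$-simplex, and that if equality holds for some $t\in(0,1)$, then $K$ is a simplex. Then for every $p\in\mathbb{N}$, $K\in\mathcal{K}(\mathbb{R}^n)$ and $t\in[0,1]$ one has $$\sum_{j=0}^n t^j(1-t)^{n-j}\,V\big(-\Delta_pK[j],K^p[np-j]\big)\leq|K|^p,$$ and if $\dim(K)=n$ and equality holds in the latter inequality for some $t\in(0,1)$, then $K$ is a simplex.
   Context: $\mathcal{K}(\mathbb{R}^n)$ denotes the set of convex bodies, i.e. nonempty compact convex subsets of $\mathbb{R}^n$; $|\cdot|$ is Lebesgue measure (in the dimension of the ambient space); $\dim K$ is the dimension of the affine span of $K$; a simplex is the convex hull of affinely independent points, an $n$-simplex that of $n+1$ such points. The mixed volume of $K_1,\dots,K_N\in\mathcal{K}(\mathbb{R}^N)$ is $V(K_1,\dots,K_N)=\frac1{N!}\frac{\partial^N}{\partial t_1\cdots\partial t_N}\big|_{t_1=\dots=t_N=0}|t_1K_1+\dots+t_NK_N|$ (Minkowski sums; the volume is a homogeneous polynomial of degree $N$ in $t_1,\dots,t_N\ge0$). $L[k]$ means that $L$ is repeated $k$ times. Identify $\mathbb{R}^{np}=(\mathbb{R}^n)^p$; $\Delta_p:\mathbb{R}^n\to\mathbb{R}^{np}$,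 $\Delta_p(x)=(x,\dots,x)$; $K^p=K\times\cdots\times K\subset\mathbb{R}^{np}$. The higher-order unbalanced difference body is $D_p^tK=(1-t)K^p-t\Delta_pK=\{(1-t)y-t\Delta_p(x):x\in K,\ y\in K^p\}\subset\mathbb{R}^{np}$. Convention $0^0=1$. (The ratio $|D_p^tS_n|/|S_n|^p$ does not depend on the choice of the $n$-simplex, by affine invariance.) *)

theory Defs
  imports "HOL-Analysis.Analysis"
begin

(* R^(np) = (R^n)^p is the space of functions nat => real^'n that are extensional on {..<p},
   i.e. the carrier of the product measure below; p has to be a term, not a type, because the
   theorem quantifies over it inside a hypothesis. All sets measured are compact, so Borel
   measure agrees with Lebesgue measure on them. *)

definition convex_body :: "(real ^ 'n) set \<Rightarrow> bool" where
  "convex_body K \<longleftrightarrow> K \<noteq> {} \<and> compact K \<and> convex K"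

definition pvol :: "nat \<Rightarrow> (nat \<Rightarrow> real ^ 'n) set \<Rightarrow> real" where
  "pvol p A = measure (\<Pi>\<^sub>M i\<in>{..<p}. lborel) A"

definition diag_emb :: "nat \<Rightarrow> real ^ 'n \<Rightarrow> (nat \<Rightarrow> real ^ 'n)" where
  "diag_emb p x = (\<lambda>i\<in>{..<p}. x)"

definition set_power :: "nat \<Rightarrow> (real ^ 'n) set \<Rightarrow> (nat \<Rightarrow> real ^ 'n) set" where
  "set_power p K = (\<Pi>\<^sub>E i\<in>{..<p}. K)"

definition neg_set :: "nat \<Rightarrow> (nat \<Rightarrow> real ^ 'n) set \<Rightarrow> (nat \<Rightarrow> real ^ 'n) set" where
  "neg_set p A = (\<lambda>x. \<lambda>i\<in>{..<p}. - x i) ` A"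

definition diff_body :: "nat \<Rightarrow> real \<Rightarrow> (real ^ 'n) set \<Rightarrow> (nat \<Rightarrow> real ^ 'n) set" where
  "diff_body p t K =
     {\<lambda>i\<in>{..<p}. (1 - t) *\<^sub>R y i - t *\<^sub>R diag_emb p x i | x y. x \<in> K \<and> y \<in> set_power p K}"

definition minkowski_comb ::
    "nat \<Rightarrow> nat \<Rightarrow> (nat \<Rightarrow> real) \<Rightarrow> (nat \<Rightarrow> (nat \<Rightarrow> real ^ 'n) set) \<Rightarrow> (nat \<Rightarrow> real ^ 'n) set" where
  "minkowski_comb p N t K =
     {\<lambda>i\<in>{..<p}. \<Sum>k<N. t k *\<^sub>R x k i | x. \<forall>k<N. x k \<in> K k}"

(* The volume of a Minkowski combination is polynomial only for nonnegative coefficients,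
   so partial derivatives are taken within [0, \<infinity>); at 0 they are one-sided. *)
definition partial_nonneg :: "nat \<Rightarrow> ((nat \<Rightarrow> real) \<Rightarrow> real) \<Rightarrow> (nat \<Rightarrow> real) \<Rightarrow> real" where
  "partial_nonneg k f t = vector_derivative (\<lambda>s. f (t(k := s))) (at (t k) within {0..})"

(* Bodies and coefficients are indexed from 0: K 0, ..., K (N - 1). *)
definition mixed_volume :: "nat \<Rightarrow> (nat \<Rightarrow> (nat \<Rightarrow> real ^ 'n) set) \<Rightarrow> real" where
  "mixed_volume p K =
     (let N = CARD('n) * p in
        1 / fact N *
          foldr partial_nonneg [0..<N] (\<lambda>t. pvol p (minkowski_comb p N t K)) (\<lambda>_. 0))"

(* V(-Delta_p K [j], K^p [np - j]) *)
definition diag_mixed_volume :: "nat \<Rightarrow> nat \<Rightarrow> (real ^ 'n) set \<Rightarrow> real" where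
  "diag_mixed_volume p j K =
     mixed_volume p (\<lambda>k. if k < j then neg_set p (diag_emb p ` K) else set_power p K)"

end

theory Submission
  imports Defs
begin

text \<open>
  For a convex body \<open>K\<close> the volume of \<open>b K\<^sup>p - a \<Delta>\<^sub>p K\<close> is a polynomial
  \<open>\<Sum>\<^sub>j (np choose j) c\<^sub>j a\<^sup>j b\<^bsup>np - j\<^esup>\<close> with \<open>j \<le> n\<close>, whose coefficients \<open>c\<^sub>j\<close> are the mixed volumes in question.
  By Fubini this follows from Steiner's formula in \<open>\<real>\<^sup>n\<close>, which for polytopes is a change of variables along
  gradients of logarithmic partition functions.
  For a simplex, integrating the volume of the intersection of translates of \<open>a S\<close> and \<open>b S\<close> over all translations gives an
  integral equation whose solution is \<open>c\<^sub>j = (n choose j) |S|\<^sup>p\<close>. Hence the hypothesis says that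
  \<open>\<Sum>\<^sub>j (np choose j) e\<^sub>j t\<^sup>j (1 - t)\<^bsup>np - j\<^esup> \<ge> 0\<close> for \<open>e\<^sub>j = (n choose j) |K|\<^sup>p - c\<^sub>j\<close>.
  As \<open>1 / (np choose j) = (np + 1) \<integral> u\<^sup>j (1 - u)\<^bsup>np - j\<^esup> du\<close> over \<open>[0, 1]\<close>, averaging over dilations of \<open>t / (1 - t)\<close>
  removes the factor \<open>np choose j\<close>, which is the claim.
\<close>

subsection \<open>Gibbs means and Minkowski sums of polytopes\<close>

text \<open>\<open>mixed_volume\<close> is an iterated one-sided derivative, so it can be evaluated
  only once the volume is known to be a polynomial. Just two bodies occur, and by convexity the
  dilates of each add up, so polynomiality in two variables suffices. The bound
  \<open>j \<le> n\<close> is geometric: the diagonal has dimension n, and \<open>a\<close> acts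
  only inside fibres of dimension n. Logarithmic partition functions are smooth on all of space, and
  the same two serve every \<open>a\<close>. Hence the domain of integration does not move with
  \<open>a\<close>, and the Jacobian matrix is affine in \<open>a\<close>. For a simplex the
  decisive fact is that intersections of homothets are homothets, of one size parameter. The n-th
  moment of that size is, by layers, a convolution of the unknown volume with
  \<open>n * r ^ (n - 1)\<close>. With \<open>b - a\<close> held fixed this operator is diagonal on
  monomials, so it can be inverted coefficient by coefficient. For the equality case the averaged
  function is nonnegative and continuous. If its integral is zero, it vanishes identically, so all
  \<open>e j\<close> are zero and the hypothesis holds with equality at the same
  \<open>t\<close>.\<close>

definition minkowski_add :: "'a::real_vector set \<Rightarrow> real \<Rightarrow> 'a set \<Rightarrow> 'a set" where
  "minkowski_add A a B = (\<lambda>(x, y). x + a *\<^sub>R y) ` (A \<times> B)"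

definition partition_fn :: "'a::real_inner set \<Rightarrow> 'a \<Rightarrow> real" where
  "partition_fn V u = (\<Sum>v\<in>V. exp (u \<bullet> v))"

definition gibbs_mean :: "'a::real_inner set \<Rightarrow> 'a \<Rightarrow> 'a" where
  "gibbs_mean V u = (\<Sum>v\<in>V. exp (u \<bullet> v) *\<^sub>R v) /\<^sub>R partition_fn V u"

text \<open>The covariance matrix of the weights
  \<open>exp (u \<bullet> v) / partition_fn V u\<close> on \<open>V\<close>, applied to
  \<open>h\<close>. Centring one factor is enough: subtracting its mean from the other would change
  nothing, as the centred factor has mean zero.\<close>

definition gibbs_cov :: "'a::real_inner set \<Rightarrow> 'a \<Rightarrow> 'a \<Rightarrow> 'a" where
  "gibbs_cov V u h = (\<Sum>v\<in>V. (exp (u \<bullet> v) * (h \<bullet> v)) *\<^sub>R (v - gibbs_mean V u)) /\<^sub>R partition_fn V u"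

lemma partition_fn_pos:
  assumes "finite V" "V \<noteq> {}" shows "partition_fn V u > 0"
  unfolding partition_fn_def using assms by (intro sum_pos) auto

lemma gibbs_mean_in_hull:
  assumes "finite V" "V \<noteq> {}" shows "gibbs_mean V u \<in> convex hull V"
proof -
  have p: "partition_fn V u > 0" using assms by (rule partition_fn_pos)
  have "gibbs_mean V u = (\<Sum>v\<in>V. (exp (u \<bullet> v) / partition_fn V u) *\<^sub>R v)"
    by (simp add: gibbs_mean_def scaleR_sum_right divide_inverse mult.commute)
  moreover have "(\<Sum>v\<in>V. exp (u \<bullet> v) / partition_fn V u) = 1"
    using p by (simp add: partition_fn_def flip: sum_divide_distrib)
  ultimately show ?thesis
    using p assms(1) by (auto simp: convex_hull_finite intro!: exI[of _ "\<lambda>v. exp (u \<bullet> v) / partition_fn V u"])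
qed

lemma gibbs_mean_eq:
  assumes "finite V" "V \<noteq> {}"
  shows "(\<Sum>v\<in>V. exp (u \<bullet> v) *\<^sub>R v) = partition_fn V u *\<^sub>R gibbs_mean V u"
  using partition_fn_pos[OF assms, of u] by (simp add: gibbs_mean_def)

text \<open>Each vertex contributes one summand of the partition function, and the bound is a
  half-space condition on \<open>x\<close>. So the logarithm dominates the support function of the
  hull, which is what makes \<open>H\<close> coercive in
  \<open>interior_subset_range\<close>.\<close>

lemma ln_partition_fn_ge:
  assumes "finite V" "x \<in> convex hull V" shows "u \<bullet> x \<le> ln (partition_fn V u)"
proof -
  have ne: "V \<noteq> {}" using assms(2) by auto
  have "v \<in> {x. u \<bullet> x \<le> ln (partition_fn V u)}" if "v \<in> V" for v
  proof -
    have "exp (u \<bullet> v) \<le> partition_fn V u"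
      unfolding partition_fn_def using assms(1) that by (intro member_le_sum) auto
    then show ?thesis using partition_fn_pos[OF assms(1) ne, of u] by (simp add: ln_ge_iff)
  qed
  then have "convex hull V \<subseteq> {x. u \<bullet> x \<le> ln (partition_fn V u)}"
    by (intro hull_minimal) (auto simp: convex_halfspace_le)
  then show ?thesis using assms(2) by auto
qed

lemma partition_fn_has_derivative:
  "(partition_fn V has_derivative (\<lambda>h. \<Sum>v\<in>V. exp (u \<bullet> v) * (h \<bullet> v))) (at u)"
  unfolding partition_fn_def
  by (auto intro!: derivative_eq_intros simp: inner_commute mult.commute)

lemma ln_partition_fn_has_derivative:
  assumes "finite V" "V \<noteq> {}"
  shows "((\<lambda>u. ln (partition_fn V u)) has_derivative (\<lambda>h. gibbs_mean V u \<bullet> h)) (at u)"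
proof -
  have "(\<Sum>v\<in>V. exp (u \<bullet> v) * (h \<bullet> v)) = (\<Sum>v\<in>V. exp (u \<bullet> v) *\<^sub>R v) \<bullet> h" for h
    by (simp add: inner_sum_left inner_commute[of h])
  then have "(\<lambda>h. gibbs_mean V u \<bullet> h) = (\<lambda>h. (\<Sum>v\<in>V. exp (u \<bullet> v) * (h \<bullet> v)) * inverse (partition_fn V u))"
    by (simp add: gibbs_mean_def mult.commute)
  then show ?thesis
    using has_derivative_ln[OF partition_fn_pos[OF assms] partition_fn_has_derivative] by simp
qed

lemma gibbs_mean_has_derivative:
  assumes "finite V" "V \<noteq> {}"
  shows "(gibbs_mean V has_derivative gibbs_cov V u) (at u)"
proof -
  let ?Z = "partition_fn V"
  let ?Z' = "\<lambda>h. \<Sum>v\<in>V. exp (u \<bullet> v) * (h \<bullet> v)"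
  have p: "?Z u > 0" using assms by (rule partition_fn_pos)
  have N: "((\<lambda>u. \<Sum>v\<in>V. exp (u \<bullet> v) *\<^sub>R v) has_derivative (\<lambda>h. \<Sum>v\<in>V. (exp (u \<bullet> v) * (h \<bullet> v)) *\<^sub>R v)) (at u)"
    by (auto intro!: derivative_eq_intros simp: inner_commute mult.commute)
  have I: "((\<lambda>u. inverse (?Z u)) has_derivative (\<lambda>h. - (inverse (?Z u) * ?Z' h * inverse (?Z u)))) (at u)"
    by (rule Deriv.has_derivative_inverse[OF _ partition_fn_has_derivative]) (use p in auto)
  have "(gibbs_mean V has_derivative
      (\<lambda>h. inverse (?Z u) *\<^sub>R (\<Sum>v\<in>V. (exp (u \<bullet> v) * (h \<bullet> v)) *\<^sub>R v)
         + (- (inverse (?Z u) * ?Z' h * inverse (?Z u))) *\<^sub>R (\<Sum>v\<in>V. exp (u \<bullet> v) *\<^sub>R v))) (at u)"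
    unfolding gibbs_mean_def[abs_def] by (rule has_derivative_scaleR[OF I N])
  moreover have "gibbs_cov V u h = inverse (?Z u) *\<^sub>R (\<Sum>v\<in>V. (exp (u \<bullet> v) * (h \<bullet> v)) *\<^sub>R v)
         + (- (inverse (?Z u) * ?Z' h * inverse (?Z u))) *\<^sub>R (\<Sum>v\<in>V. exp (u \<bullet> v) *\<^sub>R v)" for h
    unfolding gibbs_mean_eq[OF assms] gibbs_cov_def using p
    by (simp add: scaleR_diff_right sum_subtractf flip: scaleR_sum_left)
  ultimately show ?thesis by presburger
qed

text \<open>The right-hand side is the variance of \<open>v \<bullet> h\<close> under the Gibbs
  weights. Hence the form is nonnegative, and it vanishes only if all vertices have the same inner
  product with \<open>h\<close>.\<close>

lemma gibbs_cov_inner: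
  assumes "finite V" "V \<noteq> {}"
  shows "gibbs_cov V u h \<bullet> h = (\<Sum>v\<in>V. exp (u \<bullet> v) * (v \<bullet> h - gibbs_mean V u \<bullet> h)\<^sup>2) / partition_fn V u"
proof -
  let ?m = "gibbs_mean V u \<bullet> h"
  have "(\<Sum>v\<in>V. exp (u \<bullet> v) * (v \<bullet> h)) = partition_fn V u * ?m"
    using arg_cong[OF gibbs_mean_eq[OF assms, of u], of "\<lambda>x. x \<bullet> h"] by (simp add: inner_sum_left)
  then have "(\<Sum>v\<in>V. exp (u \<bullet> v) * (v \<bullet> h - ?m)) = 0"
    by (simp add: right_diff_distrib sum_subtractf partition_fn_def flip: sum_distrib_right)
  then have "(\<Sum>v\<in>V. exp (u \<bullet> v) * (v \<bullet> h - ?m) * ?m) = 0"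
    by (simp flip: sum_distrib_right)
  moreover have "(\<Sum>v\<in>V. exp (u \<bullet> v) * (v \<bullet> h - ?m)\<^sup>2) =
      (\<Sum>v\<in>V. exp (u \<bullet> v) * (h \<bullet> v) * (v \<bullet> h - ?m)) - (\<Sum>v\<in>V. exp (u \<bullet> v) * (v \<bullet> h - ?m) * ?m)"
    by (simp flip: sum_subtractf) (simp add: power2_eq_square inner_commute algebra_simps)
  ultimately show ?thesis
    by (simp add: gibbs_cov_def inner_sum_left inner_diff_left divide_inverse mult.commute)
qed

lemma gibbs_cov_nonneg:
  assumes "finite V" "V \<noteq> {}" shows "gibbs_cov V u h \<bullet> h \<ge> 0"
  unfolding gibbs_cov_inner[OF assms] using partition_fn_pos[OF assms, of u]
  by (intro divide_nonneg_pos sum_nonneg) auto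

lemma gibbs_cov_eq_0:
  assumes "finite V" "V \<noteq> {}" "gibbs_cov V u h \<bullet> h = 0" "v \<in> V" shows "v \<bullet> h = gibbs_mean V u \<bullet> h"
proof -
  have "(\<Sum>v\<in>V. exp (u \<bullet> v) * (v \<bullet> h - gibbs_mean V u \<bullet> h)\<^sup>2) = 0"
    using assms(3) partition_fn_pos[OF assms(1,2), of u] by (simp add: gibbs_cov_inner[OF assms(1,2)])
  then show ?thesis using assms(1,4) by (auto simp: sum_nonneg_eq_0_iff)
qed

lemma linear_gibbs_cov: "linear (gibbs_cov V u)"
  by (rule linearI) (simp_all add: gibbs_cov_def inner_add_left ring_distribs scaleR_add_left sum.distrib
      scaleR_add_right scaleR_sum_right ac_simps)

text \<open>\<open>gradient_map a\<close> is the gradient of \<open>ln (partition_fn V u) + a * ln (partition_fn W u)\<close>; it is a diffeomorphism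
  onto the interior of \<open>conv V + a conv W\<close>, and its Jacobian is polynomial in \<open>a\<close> (an idea of Gromov).\<close>

locale polytope_pair =
  fixes V W :: "'a::euclidean_space set"
  assumes V: "finite V" "V \<noteq> {}" and W: "finite W" "W \<noteq> {}"
    and spanning: "\<And>h \<alpha> \<beta>. h \<noteq> 0 \<Longrightarrow> \<not> ((\<forall>v\<in>V. v \<bullet> h = \<alpha>) \<and> (\<forall>w\<in>W. w \<bullet> h = \<beta>))"
begin

definition gradient_map :: "real \<Rightarrow> 'a \<Rightarrow> 'a" where
  "gradient_map a u = gibbs_mean V u + a *\<^sub>R gibbs_mean W u"

definition hessian :: "real \<Rightarrow> 'a \<Rightarrow> 'a \<Rightarrow> 'a" where
  "hessian a u h = gibbs_cov V u h + a *\<^sub>R gibbs_cov W u h"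

lemma gradient_map_has_derivative: "(gradient_map a has_derivative hessian a u) (at u)"
  unfolding gradient_map_def[abs_def] hessian_def[abs_def]
  by (auto intro!: derivative_eq_intros gibbs_mean_has_derivative V W)

text \<open>A combination of two variances with positive weights vanishes only if both do. Then
  \<open>h\<close> has constant inner product on \<open>V\<close> and on \<open>W\<close>, which
  \<open>spanning\<close> excludes.\<close>

lemma hessian_pos:
  assumes "a > 0" "h \<noteq> 0" shows "hessian a u h \<bullet> h > 0"
proof (rule ccontr)
  assume "\<not> ?thesis"
  moreover have "gibbs_cov V u h \<bullet> h \<ge> 0" "gibbs_cov W u h \<bullet> h \<ge> 0"
    using gibbs_cov_nonneg V W by auto
  ultimately have "gibbs_cov V u h \<bullet> h = 0" "a * (gibbs_cov W u h \<bullet> h) = 0"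
    using assms(1) mult_nonneg_nonneg[of a "gibbs_cov W u h \<bullet> h"]
    unfolding hessian_def inner_add_left inner_scaleR_left by linarith+
  then have "gibbs_cov V u h \<bullet> h = 0" "gibbs_cov W u h \<bullet> h = 0" using assms by auto
  then show False using spanning[OF assms(2)] gibbs_cov_eq_0 V W by blast
qed

text \<open>Along the segment from \<open>u\<close> to \<open>w\<close> the component in direction
  \<open>w - u\<close> has positive derivative by \<open>hessian_pos\<close>, so it differs at the
  two ends.\<close>

lemma inj_gradient_map: assumes "a > 0" shows "inj (gradient_map a)"
proof (rule injI, rule ccontr)
  fix u w assume eq: "gradient_map a u = gradient_map a w" and ne: "u \<noteq> w"
  let ?h = "w - u"
  let ?f = "\<lambda>s. gradient_map a (u + s *\<^sub>R ?h) \<bullet> ?h"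
  have der: "(?f has_real_derivative hessian a (u + s *\<^sub>R ?h) ?h \<bullet> ?h) (at s)" for s
  proof -
    have "((\<lambda>s. u + s *\<^sub>R ?h) has_derivative (\<lambda>r. r *\<^sub>R ?h)) (at s)"
      by (auto intro!: derivative_eq_intros)
    from has_derivative_compose[OF this gradient_map_has_derivative]
    have "((\<lambda>s. gradient_map a (u + s *\<^sub>R ?h)) has_derivative (\<lambda>r. hessian a (u + s *\<^sub>R ?h) (r *\<^sub>R ?h))) (at s)" .
    from has_derivative_inner_left[OF this, of ?h]
    have "(?f has_derivative (\<lambda>r. hessian a (u + s *\<^sub>R ?h) (r *\<^sub>R ?h) \<bullet> ?h)) (at s)" .
    moreover have "hessian a (u + s *\<^sub>R ?h) (r *\<^sub>R ?h) = r *\<^sub>R hessian a (u + s *\<^sub>R ?h) ?h" for r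
      by (simp add: hessian_def linear_scale[OF linear_gibbs_cov] scaleR_add_right)
    ultimately show ?thesis
      by (auto simp: has_field_derivative_def mult.commute elim!: has_derivative_eq_rhs)
  qed
  have "?f 0 < ?f 1"
  proof (rule DERIV_pos_imp_increasing[where f = ?f])
    show "\<exists>y. (?f has_real_derivative y) (at s) \<and> 0 < y" for s
      using der[of s] hessian_pos[OF assms, of ?h] ne by (intro exI conjI) auto
  qed simp
  then show False using eq by simp
qed

lemma gradient_map_in: "gradient_map a u \<in> minkowski_add (convex hull V) a (convex hull W)"
  using gibbs_mean_in_hull[OF V] gibbs_mean_in_hull[OF W]
  by (auto simp: gradient_map_def minkowski_add_def)

text \<open>The gradient of \<open>H u = ln (partition_fn V u) + a * ln (partition_fn W u) - u \<bullet> z\<close> vanishes at the sought preimage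
  of \<open>z\<close>, and \<open>H\<close> is coercive because a ball around \<open>z\<close> lies in the Minkowski sum.\<close>

lemma interior_subset_range:
  assumes a: "a > 0" and z: "z \<in> interior (minkowski_add (convex hull V) a (convex hull W))"
  shows "z \<in> range (gradient_map a)"
proof -
  define H where "H u = ln (partition_fn V u) + a * ln (partition_fn W u) - u \<bullet> z" for u
  obtain r where r: "r > 0" "cball z r \<subseteq> minkowski_add (convex hull V) a (convex hull W)"
    using z by (meson mem_interior_cball)
  have H': "(H has_derivative (\<lambda>h. (gradient_map a u - z) \<bullet> h)) (at u)" for u
  proof -
    have "(H has_derivative (\<lambda>h. gibbs_mean V u \<bullet> h + a * (gibbs_mean W u \<bullet> h) - h \<bullet> z)) (at u)"
      unfolding H_def[abs_def]
      by (intro has_derivative_add has_derivative_diff has_derivative_mult_right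
          ln_partition_fn_has_derivative V W has_derivative_inner_left has_derivative_ident)
    then show ?thesis
      by (rule has_derivative_eq_rhs)
         (simp add: gradient_map_def inner_add_left inner_diff_left inner_commute[of _ z])
  qed
  have coercive: "r * norm u \<le> H u" for u
  proof (cases "u = 0")
    case True
    have "z \<in> minkowski_add (convex hull V) a (convex hull W)" using r by auto
    then obtain x y where "x \<in> convex hull V" "y \<in> convex hull W" by (auto simp: minkowski_add_def)
    then have "0 \<le> ln (partition_fn V u)" "0 \<le> ln (partition_fn W u)"
      using ln_partition_fn_ge[OF V(1), of x u] ln_partition_fn_ge[OF W(1), of y u] True by auto
    then show ?thesis using True a by (simp add: H_def)
  next
    case False
    \<comment> \<open>The point of the ball that lies farthest in direction \<open>u\<close>: its
      inner product with \<open>u\<close> exceeds that of \<open>z\<close> by exactly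
      \<open>r * norm u\<close>.\<close>
    have "z + (r / norm u) *\<^sub>R u \<in> cball z r" using r False by (simp add: dist_norm)
    then obtain x y where xy: "x \<in> convex hull V" "y \<in> convex hull W" "z + (r / norm u) *\<^sub>R u = x + a *\<^sub>R y"
      using r by (auto simp: minkowski_add_def)
    have "u \<bullet> x + a * (u \<bullet> y) \<le> ln (partition_fn V u) + a * ln (partition_fn W u)"
      using ln_partition_fn_ge[OF V(1) xy(1), of u] ln_partition_fn_ge[OF W(1) xy(2), of u] a
      by (intro add_mono mult_left_mono) auto
    moreover have "u \<bullet> x + a * (u \<bullet> y) = u \<bullet> z + r * norm u"
      using arg_cong[OF xy(3), of "\<lambda>x. u \<bullet> x"] False
      by (simp add: inner_add_right power2_norm_eq_inner[symmetric] power2_eq_square)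
    ultimately show ?thesis by (simp add: H_def)
  qed
  have "continuous_on UNIV H"
    using H' by (intro differentiable_imp_continuous_on) (auto simp: differentiable_on_def differentiable_def)
  then have cont: "continuous_on (cball 0 (H 0 / r)) H" by (rule continuous_on_subset) auto
  have H0: "0 \<le> H 0" using coercive[of 0] by simp
  then have "0 \<le> H 0 / r" using r by simp
  \<comment> \<open>Outside the ball of radius \<open>H 0 / r\<close> coercivity forces values above
    \<open>H 0\<close>, so a minimum over this ball is a global minimum.\<close>
  then have ne: "cball (0::'a) (H 0 / r) \<noteq> {}" by simp
  from continuous_attains_inf[OF compact_cball ne cont]
  obtain u where "\<forall>w\<in>cball 0 (H 0 / r). H u \<le> H w" by blast
  then have u: "H u \<le> H w" if "w \<in> cball 0 (H 0 / r)" for w using that by blast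
  have min: "H u \<le> H w" for w
  proof (cases "w \<in> cball 0 (H 0 / r)")
    case False
    then have "H 0 < r * norm w" using r by (simp add: field_simps)
    then show ?thesis using coercive[of w] u[of 0] \<open>0 \<le> H 0 / r\<close> by auto
  qed (use u in auto)
  have "(\<lambda>h. (gradient_map a u - z) \<bullet> h) = (\<lambda>h. 0)"
    by (rule differential_zero_maxmin[OF _ open_UNIV H'[of u]]) (use min in auto)
  from fun_cong[OF this, of "gradient_map a u - z"] have "z = gradient_map a u" by simp
  then show ?thesis by auto
qed

end

subsection \<open>Steiner's formula\<close>

text \<open>The node with index \<open>i\<close> is \<open>i + 1\<close>. All nodes are thus
  positive and lie in the range where the volume formulas for \<open>a > 0\<close> apply.\<close>

definition lagrange_basis :: "nat \<Rightarrow> nat \<Rightarrow> real \<Rightarrow> real" where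
  "lagrange_basis n k a = (\<Prod>i\<in>{..n} - {k}. (a - (real i + 1)) / (real k - real i))"

text \<open>Lagrange interpolation at the nodes \<open>1, \<dots>, n + 1\<close>; unlike the existence of coefficients,
  this form of being a polynomial of degree at most \<open>n\<close> passes to limits and integrals at once.\<close>

definition interpolates :: "nat \<Rightarrow> (real \<Rightarrow> real) \<Rightarrow> bool" where
  "interpolates n f \<longleftrightarrow> (\<forall>a>0. f a = (\<Sum>k\<le>n. f (real k + 1) * lagrange_basis n k a))"

lemma lagrange_basis_node:
  assumes "j \<le> n" "k \<le> n" shows "lagrange_basis n k (real j + 1) = (if j = k then 1 else 0)"
proof (cases "j = k")
  case True
  then show ?thesis unfolding lagrange_basis_def by (intro trans[OF prod.neutral]) auto
next
  case False
  then show ?thesis using assms unfolding lagrange_basis_def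
    by (auto intro!: prod_zero bexI[of _ j])
qed

lemma lagrange_basis_poly:
  assumes "k \<le> n"
  shows "\<exists>q. degree q \<le> n \<and> (\<forall>a. poly q a = lagrange_basis n k a)"
proof (intro exI conjI allI)
  let ?q = "\<Prod>i\<in>{..n} - {k}. smult (1 / (real k - real i)) [:- (real i + 1), 1:]"
  have "degree ?q \<le> (\<Sum>i\<in>{..n} - {k}. degree (smult (1 / (real k - real i)) [:- (real i + 1), 1:]))"
    by (rule order_trans[OF degree_prod_sum_le]) auto
  also have "\<dots> \<le> (\<Sum>i\<in>{..n} - {k}. 1)" by (intro sum_mono order_trans[OF degree_smult_le]) auto
  also have "\<dots> = n" using assms by simp
  finally show "degree ?q \<le> n" .
  show "poly ?q a = lagrange_basis n k a" for a
    by (simp add: lagrange_basis_def poly_prod algebra_simps diff_divide_distrib add_divide_distrib)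
qed

lemma lagrange_sum_poly:
  fixes c :: "nat \<Rightarrow> real"
  shows "\<exists>q. degree q \<le> n \<and> (\<forall>a. poly q a = (\<Sum>k\<le>n. c k * lagrange_basis n k a))"
proof -
  have "\<forall>k\<in>{..n}. \<exists>q. degree q \<le> n \<and> (\<forall>a. poly q a = lagrange_basis n k a)"
    using lagrange_basis_poly by simp
  then obtain l where "\<forall>k\<in>{..n}. degree (l k) \<le> n \<and> (\<forall>a. poly (l k) a = lagrange_basis n k a)"
    unfolding bchoice_iff by blast
  then have l: "degree (l k) \<le> n" "poly (l k) a = lagrange_basis n k a" if "k \<le> n" for k a
    using that by auto
  have "degree (smult (c k) (l k)) \<le> n" if "k \<le> n" for k
    using degree_smult_le[of "c k" "l k"] l(1)[OF that] by linarith
  then have "degree (\<Sum>k\<le>n. smult (c k) (l k)) \<le> n"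
    by (intro degree_sum_le) auto
  then show ?thesis
    by (intro exI[of _ "\<Sum>k\<le>n. smult (c k) (l k)"]) (auto simp: poly_sum l)
qed

text \<open>Two polynomials of degree at most \<open>n\<close> that agree at \<open>n + 1\<close>
  nodes are equal, so \<open>q\<close> is its own interpolant.\<close>

lemma interpolates_poly:
  fixes q :: "real poly"
  assumes "degree q \<le> n" "\<And>a. a > 0 \<Longrightarrow> f a = poly q a" shows "interpolates n f"
proof -
  obtain r where r: "degree r \<le> n" "\<And>a. poly r a = (\<Sum>k\<le>n. f (real k + 1) * lagrange_basis n k a)"
    using lagrange_sum_poly[of n "\<lambda>k. f (real k + 1)"] by blast
  have "poly q a = poly r a" if node: "a \<in> (\<lambda>j. real j + 1) ` {..n}" for a
  proof -
    obtain j where j: "j \<le> n" "a = real j + 1" using node by auto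
    have "poly r a = (\<Sum>k\<le>n. if j = k then f (real k + 1) else 0)"
      unfolding r(2) j(2) by (intro sum.cong) (use j lagrange_basis_node[of j n] in auto)
    then show ?thesis using j assms(2) by simp
  qed
  moreover have "card ((\<lambda>j. real j + 1) ` {..n}) = Suc n"
    by (subst card_image) (auto simp: inj_on_def)
  ultimately have "q = r"
    using assms(1) r(1) by (intro poly_eqI_degree[of "(\<lambda>j. real j + 1) ` {..n}"]) auto
  then show ?thesis by (simp add: interpolates_def r(2) assms(2))
qed

lemma interpolates_coeffs:
  assumes "interpolates n f"
  shows "\<exists>c. \<forall>a>0. f a = (\<Sum>j\<le>n. c j * a ^ j)"
proof -
  obtain r where r: "degree r \<le> n" "\<And>a. poly r a = (\<Sum>k\<le>n. f (real k + 1) * lagrange_basis n k a)"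
    using lagrange_sum_poly[of n "\<lambda>k. f (real k + 1)"] by blast
  have "poly r a = (\<Sum>j\<le>n. coeff r j * a ^ j)" for a
    unfolding poly_altdef by (rule sum.mono_neutral_left) (use r(1) in \<open>auto simp: coeff_eq_0\<close>)
  then show ?thesis using assms r(2) by (auto simp: interpolates_def)
qed

lemma interpolates_cong:
  assumes "\<And>a. a > 0 \<Longrightarrow> f a = g a" shows "interpolates n f \<longleftrightarrow> interpolates n g"
  using assms by (simp add: interpolates_def)

lemma interpolates_uminus: "interpolates n f \<Longrightarrow> interpolates n (\<lambda>a. - f a)"
  by (simp add: interpolates_def sum_negf)

lemma interpolates_0: "interpolates n (\<lambda>_. 0)"
  by (simp add: interpolates_def)

lemma interpolates_tendsto:
  assumes "\<And>m::nat. interpolates n (f m)" "\<And>a. a > 0 \<Longrightarrow> (\<lambda>m. f m a) \<longlonglongrightarrow> g a"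
  shows "interpolates n g"
  unfolding interpolates_def
proof (intro allI impI)
  fix a :: real assume a: "a > 0"
  have "(\<lambda>m. \<Sum>k\<le>n. f m (real k + 1) * lagrange_basis n k a)
      \<longlonglongrightarrow> (\<Sum>k\<le>n. g (real k + 1) * lagrange_basis n k a)"
    by (intro tendsto_intros assms(2)) auto
  moreover have "f m a = (\<Sum>k\<le>n. f m (real k + 1) * lagrange_basis n k a)" for m
    using assms(1)[of m] a unfolding interpolates_def by blast
  ultimately have "(\<lambda>m. f m a) \<longlonglongrightarrow> (\<Sum>k\<le>n. g (real k + 1) * lagrange_basis n k a)"
    by presburger
  then show "g a = (\<Sum>k\<le>n. g (real k + 1) * lagrange_basis n k a)"
    using assms(2)[OF a] LIMSEQ_unique by blast
qed

lemma interpolates_integral: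
  fixes F :: "real \<Rightarrow> 'a::euclidean_space \<Rightarrow> real"
  assumes "\<And>u. interpolates n (\<lambda>a. F a u)" "\<And>a. a > 0 \<Longrightarrow> F a integrable_on S"
  shows "interpolates n (\<lambda>a. integral S (F a))"
  unfolding interpolates_def
proof (intro allI impI)
  fix a :: real assume a: "a > 0"
  have "integral S (F a) = integral S (\<lambda>u. \<Sum>k\<le>n. F (real k + 1) u * lagrange_basis n k a)"
    using assms(1) a by (intro integral_cong) (auto simp: interpolates_def)
  also have "\<dots> = (\<Sum>k\<le>n. integral S (\<lambda>u. F (real k + 1) u * lagrange_basis n k a))"
    by (intro integral_sum) (auto intro!: integrable_on_mult_left assms(2))
  finally show "integral S (F a) = (\<Sum>k\<le>n. integral S (F (real k + 1)) * lagrange_basis n k a)" by simp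
qed

lemma interpolates_lebesgue_integral:
  fixes F :: "real \<Rightarrow> 'a \<Rightarrow> real"
  assumes "\<And>u. u \<in> space M \<Longrightarrow> interpolates n (\<lambda>a. F a u)" "\<And>a. a > 0 \<Longrightarrow> integrable M (F a)"
  shows "interpolates n (\<lambda>a. integral\<^sup>L M (F a))"
  unfolding interpolates_def
proof (intro allI impI)
  fix a :: real assume a: "a > 0"
  have "integral\<^sup>L M (F a) = integral\<^sup>L M (\<lambda>u. \<Sum>k\<le>n. F (real k + 1) u * lagrange_basis n k a)"
    using assms(1) a by (intro Bochner_Integration.integral_cong) (auto simp: interpolates_def)
  also have "\<dots> = (\<Sum>k\<le>n. integral\<^sup>L M (\<lambda>u. F (real k + 1) u * lagrange_basis n k a))"
    by (intro Bochner_Integration.integral_sum) (auto intro!: integrable_mult_left assms(2))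
  finally show "integral\<^sup>L M (F a) = (\<Sum>k\<le>n. integral\<^sup>L M (F (real k + 1)) * lagrange_basis n k a)" by simp
qed

text \<open>In Leibniz's formula every permutation contributes a product of \<open>CARD('m)\<close>
  entries, each affine in \<open>a\<close>.\<close>

lemma det_pencil_poly:
  fixes P Q :: "real ^ 'm ^ 'm"
  shows "\<exists>q. degree q \<le> CARD('m) \<and> (\<forall>a. poly q a = det (P + a *\<^sub>R Q))"
proof (intro exI conjI allI)
  let ?q = "\<Sum>\<sigma>\<in>{\<sigma>. \<sigma> permutes (UNIV::'m set)}. smult (of_int (sign \<sigma>)) (\<Prod>i\<in>UNIV. [:P $ i $ \<sigma> i, Q $ i $ \<sigma> i:])"
  have "degree (\<Prod>i\<in>UNIV. [:P $ i $ \<sigma> i, Q $ i $ \<sigma> i:]) \<le> CARD('m)" for \<sigma> :: "'m \<Rightarrow> 'm"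
  proof -
    have "degree (\<Prod>i\<in>UNIV. [:P $ i $ \<sigma> i, Q $ i $ \<sigma> i:]) \<le> (\<Sum>i\<in>(UNIV::'m set). degree [:P $ i $ \<sigma> i, Q $ i $ \<sigma> i:])"
      by (rule order_trans[OF degree_prod_sum_le]) auto
    also have "\<dots> \<le> (\<Sum>i\<in>(UNIV::'m set). 1)" by (intro sum_mono) auto
    finally show ?thesis by simp
  qed
  then show "degree ?q \<le> CARD('m)"
    by (intro degree_sum_le) (auto simp: finite_permutations)
  show "poly ?q a = det (P + a *\<^sub>R Q)" for a
    by (simp add: det_def poly_sum poly_prod mult.commute)
qed

text \<open>By the intermediate value theorem a determinant without zeros for \<open>a > 0\<close>
  keeps its sign there, so its absolute value is the polynomial or its negative.\<close>

lemma interpolates_abs_det: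
  fixes P Q :: "real ^ 'm ^ 'm"
  assumes "\<And>a. a > 0 \<Longrightarrow> det (P + a *\<^sub>R Q) \<noteq> 0"
  shows "interpolates (CARD('m)) (\<lambda>a. \<bar>det (P + a *\<^sub>R Q)\<bar>)"
proof -
  obtain q where q: "degree q \<le> CARD('m)" "\<And>a. poly q a = det (P + a *\<^sub>R Q)"
    using det_pencil_poly by blast
  have int: "interpolates (CARD('m)) (\<lambda>a. det (P + a *\<^sub>R Q))"
    by (rule interpolates_poly[OF q(1)]) (simp add: q(2))
  have conn: "connected (poly q ` {0<..})"
    by (intro connected_continuous_image continuous_intros) auto
  have "\<not> (a > 0 \<and> b > 0 \<and> poly q a < 0 \<and> poly q b > 0)" for a b
    using connectedD_interval[OF conn, of "poly q a" "poly q b" 0] assms by (fastforce simp: q(2))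
  moreover have "poly q a \<noteq> 0" if "a > 0" for a using that assms by (simp add: q(2))
  ultimately have "(\<forall>a>0. poly q a > 0) \<or> (\<forall>a>0. poly q a < 0)"
    by (meson linorder_neqE_linordered_idom)
  then show ?thesis
  proof
    assume "\<forall>a>0. poly q a > 0"
    then show ?thesis using int by (subst interpolates_cong[where g = "\<lambda>a. det (P + a *\<^sub>R Q)"]) (auto simp: q(2))
  next
    assume "\<forall>a>0. poly q a < 0"
    then show ?thesis using interpolates_uminus[OF int]
      by (subst interpolates_cong[where g = "\<lambda>a. - det (P + a *\<^sub>R Q)"]) (auto simp: q(2))
  qed
qed

section \<open>Volumes of Minkowski sums, from polytopes to convex bodies\<close>

lemma convex_minkowski_add: "convex A \<Longrightarrow> convex B \<Longrightarrow> convex (minkowski_add A a B)"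
proof -
  assume "convex A" "convex B"
  then have "convex ((\<lambda>p. fst p + a *\<^sub>R snd p) ` (A \<times> B))"
    by (intro convex_linear_image convex_Times linearI) (auto simp: algebra_simps)
  then show ?thesis by (simp add: minkowski_add_def case_prod_unfold)
qed

lemma compact_minkowski_add:
  fixes A B :: "'a::real_normed_vector set"
  assumes "compact A" "compact B" shows "compact (minkowski_add A a B)"
  unfolding minkowski_add_def case_prod_unfold
  by (intro compact_continuous_image compact_Times assms continuous_intros)

text \<open>The range of the gradient map lies between the interior of the sum and the sum, so it
  misses only boundary points, a null set. The change of variables writes the volume as an integral
  over all of space, for every \<open>a\<close>, of a Jacobian that is polynomial in
  \<open>a\<close> at each point.\<close>

lemma steiner_nondegenerate:
  fixes V W :: "(real^'m::{finite,wellorder}) set"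
  assumes "polytope_pair V W"
  shows "interpolates (CARD('m)) (\<lambda>a. measure lebesgue (minkowski_add (convex hull V) a (convex hull W)))"
proof -
  interpret polytope_pair V W by fact
  let ?S = "\<lambda>a. minkowski_add (convex hull V) a (convex hull W)"
  let ?J = "\<lambda>a u. \<bar>det (matrix (gibbs_cov V u) + a *\<^sub>R matrix (gibbs_cov W u))\<bar>"
  have hess: "matrix (hessian a u) = matrix (gibbs_cov V u) + a *\<^sub>R matrix (gibbs_cov W u)" for a u
    by (simp add: vec_eq_iff matrix_def hessian_def)
  have lin: "linear (hessian a u)" for a u
    using gradient_map_has_derivative has_derivative_linear by blast
  have "det (matrix (hessian a u)) \<noteq> 0" if "a > 0" for a u
  proof -
    have "inj (hessian a u)"
    proof (rule linear_injective_0[OF lin, THEN iffD2], intro allI impI, rule ccontr)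
      fix h assume "hessian a u h = 0" "h \<noteq> 0"
      then show False using hessian_pos[OF that, of h u] by simp
    qed
    then show ?thesis using lin by (simp add: det_nz_iff_inj)
  qed
  then have interp: "interpolates (CARD('m)) (\<lambda>a. ?J a u)" for u
    unfolding hess by (rule interpolates_abs_det)
  have meas: "?J a integrable_on UNIV \<and> measure lebesgue (?S a) = integral UNIV (?J a)" if a: "a > 0" for a
  proof -
    have comp: "compact (?S a)" "convex (?S a)"
      using V W by (auto intro: compact_minkowski_add convex_minkowski_add finite_imp_compact_convex_hull)
    have sub: "range (gradient_map a) \<subseteq> ?S a" "interior (?S a) \<subseteq> range (gradient_map a)"
      using gradient_map_in interior_subset_range[OF a] by auto
    have "sym_diff (?S a) (range (gradient_map a)) \<subseteq> frontier (?S a)"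
      using sub comp by (auto simp: frontier_def compact_imp_closed closure_closed)
    then have neg: "negligible (sym_diff (?S a) (range (gradient_map a)))"
      using negligible_convex_frontier[OF comp(2)] negligible_subset by blast
    have rng: "range (gradient_map a) \<in> lmeasurable" "measure lebesgue (range (gradient_map a)) = measure lebesgue (?S a)"
      using lmeasurable_negligible_symdiff[OF lmeasurable_compact[OF comp(1)] neg]
        measure_negligible_symdiff[OF lmeasurable_compact[OF comp(1)] neg] by auto
    have der: "(gradient_map a has_derivative hessian a u) (at u within UNIV)" for u
      using gradient_map_has_derivative by simp
    show ?thesis
      using has_measure_differentiable_image[OF _ der inj_gradient_map[OF a], of "measure lebesgue (?S a)"] rng
      unfolding hess by (auto simp: has_integral_iff)
  qed
  have "interpolates (CARD('m)) (\<lambda>a. integral UNIV (?J a))"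
    using interp meas by (intro interpolates_integral) auto
  then show ?thesis
    by (subst interpolates_cong[where g = "\<lambda>a. integral UNIV (?J a)"]) (use meas in auto)
qed

text \<open>If the spanning condition fails, the two hulls lie in parallel hyperplanes, and so do
  all their Minkowski sums, whose volumes vanish.\<close>

lemma steiner_polytope:
  fixes V W :: "(real^'m::{finite,wellorder}) set"
  assumes V: "finite V" "V \<noteq> {}" and W: "finite W" "W \<noteq> {}"
  shows "interpolates (CARD('m)) (\<lambda>a. measure lebesgue (minkowski_add (convex hull V) a (convex hull W)))"
proof (cases "polytope_pair V W")
  case False
  then obtain h \<alpha> \<beta> where h: "h \<noteq> 0" "\<forall>v\<in>V. v \<bullet> h = \<alpha>" "\<forall>w\<in>W. w \<bullet> h = \<beta>"
    using assms by (auto simp: polytope_pair_def)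
  have "convex hull V \<subseteq> {x. h \<bullet> x = \<alpha>}" "convex hull W \<subseteq> {x. h \<bullet> x = \<beta>}"
    using h by (intro hull_minimal convex_hyperplane; auto simp: inner_commute)+
  then have "minkowski_add (convex hull V) a (convex hull W) \<subseteq> {x. h \<bullet> x = \<alpha> + a * \<beta>}" for a
    by (fastforce simp: minkowski_add_def inner_add_right)
  then have "negligible (minkowski_add (convex hull V) a (convex hull W))" for a
    using negligible_hyperplane[of h] h(1) negligible_subset by blast
  then have "measure lebesgue (minkowski_add (convex hull V) a (convex hull W)) = 0" for a
    by (simp add: negligible_imp_measure0)
  then show ?thesis by (simp add: interpolates_0)
qed (rule steiner_nondegenerate)

lemma countable_dense_sequence:
  fixes A :: "'a::euclidean_space set"
  assumes "A \<noteq> {}"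
  obtains v :: "nat \<Rightarrow> 'a" where "range v \<subseteq> A" "A \<subseteq> closure (range v)"
proof -
  obtain T where T: "countable T" "T \<subseteq> A" "A \<subseteq> closure T"
    using separable by blast
  then have "T \<noteq> {}" using assms by auto
  then show ?thesis using T that[of "from_nat_into T"] by (simp add: range_from_nat_into)
qed

text \<open>Hulls of initial segments of dense sequences approximate both bodies from inside.
  Continuity of measure along the increasing sums gives the convergence under which interpolation is
  stable.\<close>

lemma steiner_wellorder:
  fixes A B :: "(real^'m::{finite,wellorder}) set"
  assumes A: "compact A" "convex A" "A \<noteq> {}" and B: "compact B" "convex B" "B \<noteq> {}"
  shows "interpolates (CARD('m)) (\<lambda>a. measure lebesgue (minkowski_add A a B))"
proof -
  obtain v where v: "range (v :: nat \<Rightarrow> _) \<subseteq> A" "A \<subseteq> closure (range v)" by (rule countable_dense_sequence[OF A(3)])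
  obtain w where w: "range (w :: nat \<Rightarrow> _) \<subseteq> B" "B \<subseteq> closure (range w)" by (rule countable_dense_sequence[OF B(3)])
  define E where "E m a = minkowski_add (convex hull (v ` {..m})) a (convex hull (w ` {..m}))" for m a
  have "interpolates (CARD('m)) (\<lambda>a. measure lebesgue (E m a))" for m
    unfolding E_def by (rule steiner_polytope) auto
  moreover have "(\<lambda>m. measure lebesgue (E m a)) \<longlonglongrightarrow> measure lebesgue (minkowski_add A a B)" if "a > 0" for a
  proof -
    let ?S = "minkowski_add A a B"
    define U where "U = (\<Union>m. E m a)"
    have comp: "compact ?S" "convex ?S" using A B by (auto intro: compact_minkowski_add convex_minkowski_add)
    have E: "compact (E m a)" "convex (E m a)" for m
      unfolding E_def by (auto intro!: compact_minkowski_add convex_minkowski_add finite_imp_compact_convex_hull)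
    have mono: "E m a \<subseteq> E m' a" if "m \<le> m'" for m m'
    proof -
      have "convex hull (v ` {..m}) \<subseteq> convex hull (v ` {..m'})" "convex hull (w ` {..m}) \<subseteq> convex hull (w ` {..m'})"
        using that by (auto intro!: hull_mono)
      then show ?thesis unfolding E_def minkowski_add_def by auto
    qed
    have sub: "E m a \<subseteq> ?S" for m
    proof -
      have "convex hull (v ` {..m}) \<subseteq> A" "convex hull (w ` {..m}) \<subseteq> B"
        using v(1) w(1) A(2) B(2) by (intro hull_minimal; auto)+
      then show ?thesis unfolding E_def minkowski_add_def by auto
    qed
    have "convex U" unfolding U_def
    proof (rule convex_def[THEN iffD2], intro ballI allI impI)
      fix x y :: "real^'m::{finite,wellorder}" and s t :: real
      assume "x \<in> (\<Union>m. E m a)" "y \<in> (\<Union>m. E m a)" and st: "s \<ge> 0" "t \<ge> 0" "s + t = 1"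
      then obtain i j where "x \<in> E i a" "y \<in> E j a" by blast
      then have "x \<in> E (max i j) a" "y \<in> E (max i j) a" using mono[of i "max i j"] mono[of j "max i j"] by auto
      then show "s *\<^sub>R x + t *\<^sub>R y \<in> (\<Union>m. E m a)" using convexD[OF E(2)] st by blast
    qed
    have "?S \<subseteq> closure U"
    proof
      fix z assume "z \<in> ?S"
      then obtain x y where xy: "x \<in> A" "y \<in> B" "z = x + a *\<^sub>R y" by (auto simp: minkowski_add_def)
      have sub: "minkowski_add (range v) a (range w) \<subseteq> U"
      proof -
        have "v i + a *\<^sub>R w j \<in> E (max i j) a" for i j
          unfolding E_def minkowski_add_def by (auto intro!: image_eqI[of _ _ "(v i, w j)"] hull_inc)
        then show ?thesis by (auto simp: minkowski_add_def U_def)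
      qed
      obtain f g where fg: "\<forall>n. f n \<in> range v" "f \<longlonglongrightarrow> x" "\<forall>n. g n \<in> range w" "g \<longlonglongrightarrow> y"
        using subsetD[OF v(2) xy(1)] subsetD[OF w(2) xy(2)] unfolding closure_sequential by blast
      have "f n + a *\<^sub>R g n \<in> U" for n
      proof -
        have "f n + a *\<^sub>R g n \<in> minkowski_add (range v) a (range w)"
          using fg unfolding minkowski_add_def by (intro image_eqI[of _ _ "(f n, g n)"]) auto
        then show ?thesis using sub by blast
      qed
      moreover have "(\<lambda>n. f n + a *\<^sub>R g n) \<longlonglongrightarrow> z"
        unfolding xy(3) by (intro tendsto_intros fg)
      ultimately show "z \<in> closure U" unfolding closure_sequential by (intro exI[of _ "\<lambda>n. f n + a *\<^sub>R g n"]) auto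
    qed
    moreover have US: "U \<subseteq> ?S" using sub by (auto simp: U_def)
    then have "closure U \<subseteq> ?S" using comp(1) by (simp add: closure_minimal compact_imp_closed)
    ultimately have cl: "closure U = ?S" by auto
    \<comment> \<open>A convex set contains the interior of its closure, so \<open>U\<close> misses
      only boundary points of \<open>?S\<close>.\<close>
    have "sym_diff ?S U \<subseteq> frontier ?S"
      using US convex_interior_closure[OF \<open>convex U\<close>] interior_subset[of U] comp(1)
      unfolding cl frontier_def by (auto simp: compact_imp_closed)
    then have neg: "negligible (sym_diff ?S U)"
      using negligible_convex_frontier[OF comp(2)] negligible_subset by blast
    have U: "U \<in> lmeasurable" "measure lebesgue U = measure lebesgue ?S"
      using lmeasurable_negligible_symdiff[OF lmeasurable_compact[OF comp(1)] neg]
        measure_negligible_symdiff[OF lmeasurable_compact[OF comp(1)] neg] by auto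
    have "(\<lambda>m. measure lebesgue (E m a)) \<longlonglongrightarrow> measure lebesgue U"
      unfolding U_def
    proof (rule Lim_measure_incseq)
      show "range (\<lambda>m. E m a) \<subseteq> sets lebesgue" using E lmeasurable_compact by blast
      show "incseq (\<lambda>m. E m a)" using mono by (simp add: incseq_def)
      show "emeasure lebesgue (\<Union>m. E m a) \<noteq> \<infinity>" using U(1) unfolding U_def fmeasurable_def by auto
    qed
    then show ?thesis using U by simp
  qed
  ultimately show ?thesis by (rule interpolates_tendsto)
qed

text \<open>The change of variables theorem is only available for vectors indexed by a well-ordered type,
  hence this well-ordered copy of an arbitrary finite index type.\<close>

typedef 'n well_ordered = "UNIV :: 'n set" by simp

definition enum_index :: "'n::finite well_ordered \<Rightarrow> nat" where
  "enum_index i = (SOME f. inj f) (Rep_well_ordered i)"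

lemma inj_enum_index: "inj (enum_index :: 'n::finite well_ordered \<Rightarrow> nat)"
proof -
  have "\<exists>f::'n \<Rightarrow> nat. inj f" using finite_imp_inj_to_nat_seg[OF finite[of "UNIV :: 'n set"]] by blast
  then have inj: "inj (SOME f::'n \<Rightarrow> nat. inj f)" by (rule someI_ex)
  show ?thesis
    by (rule injI) (simp add: enum_index_def inj_eq[OF inj] Rep_well_ordered_inject)
qed

instantiation well_ordered :: (finite) "{finite, wellorder}"
begin

definition less_eq_well_ordered :: "'a well_ordered \<Rightarrow> 'a well_ordered \<Rightarrow> bool" where
  "i \<le> j \<longleftrightarrow> enum_index i \<le> enum_index j"

definition less_well_ordered :: "'a well_ordered \<Rightarrow> 'a well_ordered \<Rightarrow> bool" where
  "i < j \<longleftrightarrow> enum_index i < enum_index j"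

instance
proof
  show "finite (UNIV :: 'a well_ordered set)"
    by (rule finite_imageD[of Rep_well_ordered]) (auto simp: inj_def Rep_well_ordered_inject)
  fix P :: "'a well_ordered \<Rightarrow> bool" and a
  assume step: "\<And>i. (\<And>j. j < i \<Longrightarrow> P j) \<Longrightarrow> P i"
  show "P a"
    by (induction a rule: measure_induct_rule[of enum_index]) (auto simp: less_well_ordered_def intro: step)
qed (use inj_enum_index in \<open>auto simp: less_eq_well_ordered_def less_well_ordered_def inj_def\<close>)

end

lemma bij_Rep_well_ordered: "bij Rep_well_ordered"
  by (rule bijI') (auto simp: Rep_well_ordered_inject intro: Rep_well_ordered_cases)

definition reindex :: "real ^ 'n \<Rightarrow> real ^ 'n::finite well_ordered" where
  "reindex x = (\<chi> i. x $ Rep_well_ordered i)"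

lemma linear_reindex: "linear reindex"
  by (rule linearI) (simp_all add: reindex_def vec_eq_iff)

lemma emeasure_box_cart:
  fixes l u :: "real ^ 'n"
  assumes "\<And>i. l $ i \<le> u $ i"
  shows "emeasure lborel (box l u) = (\<Prod>i\<in>UNIV. u $ i - l $ i)"
proof -
  have "(\<Prod>b\<in>Basis. (u - l) \<bullet> b) = (\<Prod>i\<in>UNIV. u $ i - l $ i)"
    by (rule prod.reindex_cong[of "\<lambda>i. axis i 1"]) (auto simp: Basis_vec_def inj_on_def axis_eq_axis inner_axis)
  then show ?thesis
    using assms by (subst emeasure_lborel_box) (auto simp: Basis_vec_def inner_axis)
qed

text \<open>Lebesgue measure is determined by boxes, and renaming coordinates maps boxes to boxes
  with the same side lengths.\<close>

lemma distr_reindex: "distr lborel borel reindex = (lborel :: (real ^ 'n::finite well_ordered) measure)"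
proof (rule lborel_eqI[symmetric])
  have meas: "reindex \<in> borel_measurable (borel :: (real ^ 'n) measure)"
    by (intro borel_measurable_continuous_onI linear_continuous_on linear_conv_bounded_linear[THEN iffD1] linear_reindex)
  fix l u :: "real ^ 'n well_ordered" assume lu: "\<And>b. b \<in> Basis \<Longrightarrow> l \<bullet> b \<le> u \<bullet> b"
  have le: "l $ i \<le> u $ i" for i using lu[of "axis i 1"] by (simp add: axis_in_Basis_iff inner_axis)
  let ?inv = "\<lambda>x::real ^ 'n well_ordered. (\<chi> i. x $ Abs_well_ordered i)"
  have "reindex -` box l u = box (?inv l) (?inv u)"
    unfolding reindex_def mem_box_cart set_eq_iff vimage_def
    by (auto simp: mem_box_cart) (metis Abs_well_ordered_inverse Rep_well_ordered_inverse UNIV_I)+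
  then have "emeasure (distr lborel borel reindex) (box l u) = emeasure lborel (box (?inv l) (?inv u))"
    using meas by (simp add: emeasure_distr)
  also have "\<dots> = (\<Prod>i\<in>UNIV. ?inv u $ i - ?inv l $ i)"
    by (rule emeasure_box_cart) (simp add: le)
  also have "(\<Prod>i\<in>UNIV. ?inv u $ i - ?inv l $ i) = (\<Prod>i\<in>UNIV. u $ i - l $ i)"
    by (rule prod.reindex_bij_betw[OF bij_Rep_well_ordered, symmetric, THEN trans])
       (simp add: Rep_well_ordered_inverse)
  also have "ennreal \<dots> = emeasure lborel (box l u)"
    by (rule emeasure_box_cart[symmetric]) (rule le)
  also have "\<dots> = (\<Prod>b\<in>Basis. (u - l) \<bullet> b)"
    using lu by simp
  finally show "emeasure (distr lborel borel reindex) (box l u) = (\<Prod>b\<in>Basis. (u - l) \<bullet> b)" .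
qed simp

lemma measure_reindex:
  fixes S :: "(real ^ 'n) set"
  assumes "compact S" shows "measure lebesgue (reindex ` S) = measure lborel S"
proof -
  have cont: "continuous_on UNIV (reindex :: real ^ 'n \<Rightarrow> _)"
    by (intro linear_continuous_on linear_conv_bounded_linear[THEN iffD1] linear_reindex)
  then have "compact (reindex ` S)" using assms continuous_on_subset compact_continuous_image by blast
  then have borel: "reindex ` S \<in> sets borel" by (simp add: compact_imp_closed)
  have "inj (reindex :: real ^ 'n \<Rightarrow> _)"
    by (auto simp: inj_def reindex_def vec_eq_iff) (metis Abs_well_ordered_inverse UNIV_I)
  then have vim: "reindex -` reindex ` S = S" by (simp add: inj_vimage_image_eq)
  have "measure lebesgue (reindex ` S) = measure lborel (reindex ` S)"
    using borel by (simp add: measure_completion)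
  also have "\<dots> = measure lborel S"
    using borel cont unfolding distr_reindex[symmetric]
    by (subst measure_distr) (auto intro: borel_measurable_continuous_onI simp: vim)
  finally show ?thesis .
qed

lemma steiner:
  fixes A B :: "(real ^ 'n) set"
  assumes A: "compact A" "convex A" and B: "compact B" "convex B"
  shows "interpolates (CARD('n)) (\<lambda>a. measure lborel (minkowski_add A a B))"
proof (cases "A = {} \<or> B = {}")
  case True
  then show ?thesis by (auto simp: minkowski_add_def interpolates_0)
next
  case False
  have bl: "bounded_linear (reindex :: real ^ 'n \<Rightarrow> _)"
    using linear_reindex by (simp add: linear_conv_bounded_linear)
  have img: "reindex ` minkowski_add A a B = minkowski_add (reindex ` A) a (reindex ` B)" for a
    by (auto simp: minkowski_add_def image_iff linear_add[OF linear_reindex] linear_scale[OF linear_reindex]) metis+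
  have "bij_betw (Rep_well_ordered :: 'n well_ordered \<Rightarrow> 'n) UNIV UNIV" by (rule bij_Rep_well_ordered)
  then have card: "CARD('n well_ordered) = CARD('n)" by (rule bij_betw_same_card)
  have "interpolates (CARD('n well_ordered)) (\<lambda>a. measure lebesgue (minkowski_add (reindex ` A) a (reindex ` B)))"
    using False A B by (intro steiner_wellorder convex_linear_image linear_reindex
      compact_continuous_image linear_continuous_on[OF bl]) auto
  moreover have "measure lebesgue (minkowski_add (reindex ` A) a (reindex ` B)) = measure lborel (minkowski_add A a B)" for a
    unfolding img[symmetric] using A B by (intro measure_reindex compact_minkowski_add)
  ultimately show ?thesis by (simp add: card)
qed

subsection \<open>Product measure of dilated bodies\<close>

abbreviation lborel_power :: "nat \<Rightarrow> (nat \<Rightarrow> real ^ 'n) measure" where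
  "lborel_power p \<equiv> \<Pi>\<^sub>M i\<in>{..<p}. lborel"

text \<open>This is \<open>Y\<^sup>p - \<Delta>\<^sub>p X\<close>: the \<open>z\<close> for which the bodies \<open>Y - z i\<close> have a common point in \<open>X\<close>.\<close>

definition hitting_set :: "nat \<Rightarrow> (real ^ 'n) set \<Rightarrow> (real ^ 'n) set \<Rightarrow> (nat \<Rightarrow> real ^ 'n) set" where
  "hitting_set p X Y = {z \<in> space (lborel_power p). \<exists>x\<in>X. \<forall>i<p. z i + x \<in> Y}"

interpretation lborel_product: product_sigma_finite "\<lambda>_::nat. lborel :: (real ^ 'n) measure" ..

text \<open>The existential quantifier ranges over an uncountable set. It is replaced by countable
  ones: for each \<open>m\<close> some point of a dense sequence brings all \<open>z i + v k\<close>
  within \<open>1 / (m + 1)\<close> of \<open>Y\<close>. Compactness of \<open>X\<close> recovers an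
  exact witness as the limit of a subsequence.\<close>

lemma hitting_set_measurable:
  fixes X Y :: "(real ^ 'n) set"
  assumes X: "compact X" "X \<noteq> {}" and Y: "compact Y" "Y \<noteq> {}"
  shows "hitting_set p X Y \<in> sets (lborel_power p)"
proof -
  obtain v where v: "range (v :: nat \<Rightarrow> _) \<subseteq> X" "X \<subseteq> closure (range v)"
    by (rule countable_dense_sequence[OF X(2)])
  let ?A = "\<lambda>m k. {z \<in> space (lborel_power p). \<forall>i<p. infdist (z i + v k) Y < 1 / (real m + 1)}"
  have "hitting_set p X Y = (\<Inter>m. \<Union>k. ?A m k)"
  proof (intro equalityI subsetI)
    fix z assume "z \<in> hitting_set p X Y"
    then obtain x where x: "z \<in> space (lborel_power p)" "x \<in> X" "\<And>i. i < p \<Longrightarrow> z i + x \<in> Y"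
      by (auto simp: hitting_set_def)
    have "\<exists>k. z \<in> ?A m k" for m
    proof -
      have "x \<in> closure (range v)" using v x by blast
      then obtain k where k: "dist (v k) x < 1 / (real m + 1)"
        unfolding closure_approachable by (metis divide_pos_pos of_nat_0_le_iff add_nonneg_pos zero_less_one rangeE)
      have "infdist (z i + v k) Y < 1 / (real m + 1)" if "i < p" for i
        using infdist_le[OF x(3)[OF that], of "z i + v k"] k by (simp add: dist_norm)
      then show ?thesis using x(1) by blast
    qed
    then show "z \<in> (\<Inter>m. \<Union>k. ?A m k)" by blast
  next
    fix z assume z: "z \<in> (\<Inter>m. \<Union>k. ?A m k)"
    then have "\<forall>m. \<exists>k. z \<in> ?A m k" by blast
    then obtain k where "\<forall>m. z \<in> ?A m (k m)" using choice[of "\<lambda>m k. z \<in> ?A m k"] by blast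
    then have k: "z \<in> ?A m (k m)" for m by blast
    have "\<forall>m. v (k m) \<in> X" using v by auto
    then obtain x r where x: "x \<in> X" and r: "strict_mono r" "((\<lambda>m. v (k m)) \<circ> r) \<longlonglongrightarrow> x"
      using X(1) unfolding compact_def by meson
    have "z i + x \<in> Y" if i: "i < p" for i
    proof -
      have "(\<lambda>m. infdist (z i + ((\<lambda>m. v (k m)) \<circ> r) m) Y) \<longlonglongrightarrow> infdist (z i + x) Y"
        by (intro tendsto_infdist tendsto_intros r)
      moreover have "(\<lambda>m. 1 / (real (r m) + 1)) \<longlonglongrightarrow> 0"
      proof -
        have "((\<lambda>m. 1 / (real m + 1)) \<circ> r) \<longlonglongrightarrow> 0"
          using r(1) LIMSEQ_Suc[OF lim_1_over_n[where 'a=real]]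
          by (intro LIMSEQ_subseq_LIMSEQ) (simp_all add: add.commute)
        then show ?thesis by (simp add: o_def)
      qed
      ultimately have "infdist (z i + x) Y \<le> 0"
        by (rule LIMSEQ_le) (use k i in \<open>auto intro!: exI[of _ 0] less_imp_le\<close>)
      then show ?thesis
        using Y in_closed_iff_infdist_zero[of Y] infdist_nonneg[of "z i + x" Y] by (simp add: compact_imp_closed)
    qed
    moreover have "z \<in> space (lborel_power p)" using z by auto
    ultimately show "z \<in> hitting_set p X Y" using x by (auto simp: hitting_set_def)
  qed
  also have "\<dots> \<in> sets (lborel_power p)"
  proof -
    have "?A m k \<in> sets (lborel_power p)" for m k
    proof -
      have "{z \<in> space (lborel_power p). infdist (z i + v k) Y < 1 / (real m + 1)} \<in> sets (lborel_power p)"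
        if "i \<in> {..<p}" for i
      proof -
        have [measurable]: "(\<lambda>x. infdist (x + v k) Y) \<in> borel_measurable borel"
          by (intro borel_measurable_continuous_onI continuous_intros)
        have [measurable]: "(\<lambda>z. z i) \<in> measurable (lborel_power p) lborel"
          using that by (rule measurable_component_singleton)
        have "(\<lambda>z. infdist (z i + v k) Y) \<in> borel_measurable (lborel_power p)"
          using measurable_compose[of "\<lambda>z. z i" "lborel_power p" lborel "\<lambda>x. infdist (x + v k) Y" borel] that
          by simp
        then show ?thesis by simp
      qed
      from sets.sets_Collect_finite_All[OF this finite_lessThan]
      show ?thesis by (simp only: Ball_def lessThan_iff)
    qed
    then show ?thesis
      by (intro sets.countable_INT sets.countable_UN image_subsetI) (assumption | rule UNIV_not_empty)+
  qed
  finally show ?thesis .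
qed

lemma hitting_set_mono: "X \<subseteq> X' \<Longrightarrow> Y \<subseteq> Y' \<Longrightarrow> hitting_set p X Y \<subseteq> hitting_set p X' Y'"
  unfolding hitting_set_def by blast

lemma hitting_set_subset:
  "hitting_set p X Y \<subseteq> (\<Pi>\<^sub>E i\<in>{..<p}. minkowski_add Y (-1) X)"
  by (force simp: hitting_set_def space_PiM PiE_iff minkowski_add_def)

lemma emeasure_hitting_set_finite:
  fixes X Y :: "(real ^ 'n) set"
  assumes "compact X" "compact Y"
  shows "emeasure (lborel_power p) (hitting_set p X Y) < \<infinity>"
proof -
  have comp: "compact (minkowski_add Y (-1) X)" by (rule compact_minkowski_add[OF assms(2,1)])
  then have "emeasure (lborel_power p) (\<Pi>\<^sub>E i\<in>{..<p}. minkowski_add Y (-1) X) =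
      (\<Prod>i<p. emeasure lborel (minkowski_add Y (-1) X))"
    by (intro lborel_product.emeasure_PiM) (auto simp: compact_imp_closed)
  also have "\<dots> < \<infinity>" using emeasure_compact_finite[OF comp] by (simp add: power_less_top_ennreal)
  finally have fin: "emeasure (lborel_power p) (\<Pi>\<^sub>E i\<in>{..<p}. minkowski_add Y (-1) X) < \<infinity>" .
  have "emeasure (lborel_power p) (hitting_set p X Y) \<le> emeasure (lborel_power p) (\<Pi>\<^sub>E i\<in>{..<p}. minkowski_add Y (-1) X)"
    using comp by (intro emeasure_mono hitting_set_subset sets_PiM_I_finite) (auto simp: compact_imp_closed)
  then show ?thesis using fin by order
qed

text \<open>Continuity from above, once hitting sets commute with decreasing intersections. They do
  because the sets \<open>F m\<close> of admissible \<open>x\<close> are nested nonempty compacta,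
  so that one \<open>x\<close> serves every \<open>m\<close>. This carries polynomial formulas to
  dilation factors zero.\<close>

lemma pvol_hitting_set_decseq:
  fixes X Y :: "nat \<Rightarrow> (real ^ 'n) set"
  assumes X: "\<And>m. compact (X m)" "\<And>m. X m \<noteq> {}" "decseq X" and Y: "\<And>m. compact (Y m)" "\<And>m. Y m \<noteq> {}" "decseq Y"
  shows "(\<lambda>m. pvol p (hitting_set p (X m) (Y m))) \<longlonglongrightarrow> pvol p (hitting_set p (\<Inter>m. X m) (\<Inter>m. Y m))"
proof -
  have eq: "hitting_set p (\<Inter>m. X m) (\<Inter>m. Y m) = (\<Inter>m. hitting_set p (X m) (Y m))"
  proof (intro equalityI subsetI)
    fix z assume z: "z \<in> (\<Inter>m. hitting_set p (X m) (Y m))"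
    define F where "F m = X m \<inter> {x. \<forall>i\<in>{..<p}. z i + x \<in> Y m}" for m
    have "closed {x. \<forall>i\<in>{..<p}. z i + x \<in> Y m}" for m
    proof -
      have "{x. z i + x \<in> Y m} = (\<lambda>y. y - z i) ` Y m" for i
        by (auto simp: image_iff algebra_simps)
      then have "closed {x. z i + x \<in> Y m}" for i
        using Y(1)[of m] by (simp add: compact_translation_subtract compact_imp_closed)
      then have "closed (\<Inter>i\<in>{..<p}. {x. z i + x \<in> Y m})" by blast
      moreover have "(\<Inter>i\<in>{..<p}. {x. z i + x \<in> Y m}) = {x. \<forall>i\<in>{..<p}. z i + x \<in> Y m}" by auto
      ultimately show ?thesis by simp
    qed
    then have "compact (F m)" for m unfolding F_def using X(1) by (rule compact_Int_closed[rotated])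
    moreover have "F m \<noteq> {}" for m using z by (fastforce simp: F_def hitting_set_def)
    moreover have "F m' \<subseteq> F m" if "m \<le> m'" for m m'
      using that X(3) Y(3) by (fastforce simp: F_def decseq_def)
    ultimately have "\<Inter>(range F) \<noteq> {}" by (intro compact_nest)
    then obtain x where "\<forall>m. x \<in> F m" by blast
    then show "z \<in> hitting_set p (\<Inter>m. X m) (\<Inter>m. Y m)"
      using z by (fastforce simp: F_def hitting_set_def)
  qed (auto simp: hitting_set_def)
  have mono: "decseq (\<lambda>m. hitting_set p (X m) (Y m))"
    unfolding decseq_def
  proof (intro allI impI)
    fix m m' :: nat assume "m \<le> m'"
    then have "X m' \<subseteq> X m" "Y m' \<subseteq> Y m" using X(3) Y(3) by (auto simp: decseq_def)
    then show "hitting_set p (X m') (Y m') \<subseteq> hitting_set p (X m) (Y m)"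
      by (rule hitting_set_mono)
  qed
  show ?thesis
    unfolding pvol_def eq
  proof (rule Lim_measure_decseq)
    show "range (\<lambda>m. hitting_set p (X m) (Y m)) \<subseteq> sets (lborel_power p)"
      using X Y hitting_set_measurable by blast
    show "decseq (\<lambda>m. hitting_set p (X m) (Y m))" by (rule mono)
    show "emeasure (lborel_power p) (hitting_set p (X m) (Y m)) \<noteq> \<infinity>" for m
      using emeasure_hitting_set_finite[OF X(1) Y(1), of p m m] by simp
  qed
qed

section \<open>Dilations and translations in the product space\<close>

lemma emeasure_lborel_affine:
  fixes A :: "'a::euclidean_space set"
  assumes "r > 0" "A \<in> sets borel"
  shows "emeasure lborel A = ennreal (r ^ DIM('a)) * emeasure lborel {x. r *\<^sub>R x + c \<in> A}"
proof -
  have "emeasure lborel A = emeasure (density (distr lborel borel (\<lambda>x. c + r *\<^sub>R x)) (\<lambda>_. ennreal (\<bar>r\<bar> ^ DIM('a)))) A"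
    by (rule arg_cong[where f = "\<lambda>M. emeasure M A", OF lborel_affine]) (use assms(1) in simp)
  also have "\<dots> = ennreal (r ^ DIM('a)) * emeasure (distr lborel borel (\<lambda>x. c + r *\<^sub>R x)) A"
    using assms by (simp add: emeasure_density nn_integral_cmult_indicator)
  also have "emeasure (distr lborel borel (\<lambda>x. c + r *\<^sub>R x)) A = emeasure lborel {x. r *\<^sub>R x + c \<in> A}"
    using assms by (subst emeasure_distr) (auto simp: vimage_def add.commute)
  finally show ?thesis .
qed

lemma lborel_power_affine:
  fixes c :: "nat \<Rightarrow> real ^ 'n"
  assumes "r > 0"
  shows "scale_measure (ennreal (r ^ (CARD('n) * p)))
     (distr (lborel_power p) (lborel_power p) (\<lambda>z. \<lambda>i\<in>{..<p}. r *\<^sub>R z i + c i)) = lborel_power p"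
proof (rule lborel_product.PiM_eqI)
  have meas: "(\<lambda>z. \<lambda>i\<in>{..<p}. r *\<^sub>R z i + c i) \<in> lborel_power p \<rightarrow>\<^sub>M lborel_power p"
    by measurable
  fix A :: "nat \<Rightarrow> (real ^ 'n) set" assume A: "\<And>i. i \<in> {..<p} \<Longrightarrow> A i \<in> sets lborel"
  have sets: "{x. r *\<^sub>R x + c i \<in> A i} \<in> sets lborel" if "i < p" for i
  proof -
    have "(\<lambda>x. r *\<^sub>R x + c i) -` A i \<inter> space borel \<in> sets borel"
      by (rule measurable_sets[of _ _ borel]) (use A that in auto)
    then show ?thesis by (simp add: vimage_def)
  qed
  have "emeasure (distr (lborel_power p) (lborel_power p) (\<lambda>z. \<lambda>i\<in>{..<p}. r *\<^sub>R z i + c i)) (Pi\<^sub>E {..<p} A)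
     = emeasure (lborel_power p) (\<Pi>\<^sub>E i\<in>{..<p}. {x. r *\<^sub>R x + c i \<in> A i})"
    using A meas by (subst emeasure_distr) (auto intro!: arg_cong2[where f = emeasure] sets_PiM_I_finite simp: space_PiM PiE_iff)
  also have "\<dots> = (\<Prod>i<p. emeasure lborel {x. r *\<^sub>R x + c i \<in> A i})"
    using sets by (intro lborel_product.emeasure_PiM) auto
  finally have *: "emeasure (distr (lborel_power p) (lborel_power p) (\<lambda>z. \<lambda>i\<in>{..<p}. r *\<^sub>R z i + c i)) (Pi\<^sub>E {..<p} A)
     = (\<Prod>i<p. emeasure lborel {x. r *\<^sub>R x + c i \<in> A i})" .
  have "(\<Prod>i<p. emeasure lborel (A i)) = (\<Prod>i<p. ennreal (r ^ CARD('n)) * emeasure lborel {x. r *\<^sub>R x + c i \<in> A i})"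
    using A by (intro prod.cong emeasure_lborel_affine[OF assms, where 'a = "real ^ 'n", simplified DIM_cart DIM_real mult_1_right]) auto
  also have "\<dots> = ennreal (r ^ (CARD('n) * p)) * (\<Prod>i<p. emeasure lborel {x. r *\<^sub>R x + c i \<in> A i})"
    using assms by (simp add: prod.distrib ennreal_power power_mult)
  finally show "emeasure (scale_measure (ennreal (r ^ (CARD('n) * p)))
     (distr (lborel_power p) (lborel_power p) (\<lambda>z. \<lambda>i\<in>{..<p}. r *\<^sub>R z i + c i))) (Pi\<^sub>E {..<p} A) = (\<Prod>i\<in>{..<p}. emeasure lborel (A i))"
    using * by simp
qed simp_all

lemma pvol_affine:
  fixes c :: "nat \<Rightarrow> real ^ 'n"
  assumes "r > 0" "A \<in> sets (lborel_power p)"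
  shows "pvol p A = r ^ (CARD('n) * p) * pvol p {z \<in> space (lborel_power p). (\<lambda>i\<in>{..<p}. r *\<^sub>R z i + c i) \<in> A}"
proof -
  have meas: "(\<lambda>z. \<lambda>i\<in>{..<p}. r *\<^sub>R z i + c i) \<in> lborel_power p \<rightarrow>\<^sub>M lborel_power p"
    by measurable
  have "emeasure (lborel_power p) A = ennreal (r ^ (CARD('n) * p)) *
      emeasure (distr (lborel_power p) (lborel_power p) (\<lambda>z. \<lambda>i\<in>{..<p}. r *\<^sub>R z i + c i)) A"
    by (subst lborel_power_affine[OF assms(1), symmetric, of p c]) simp
  also have "emeasure (distr (lborel_power p) (lborel_power p) (\<lambda>z. \<lambda>i\<in>{..<p}. r *\<^sub>R z i + c i)) A
     = emeasure (lborel_power p) {z \<in> space (lborel_power p). (\<lambda>i\<in>{..<p}. r *\<^sub>R z i + c i) \<in> A}"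
    using meas assms(2) by (subst emeasure_distr) (auto intro!: arg_cong2[where f = emeasure])
  finally show ?thesis using assms(1) by (simp add: pvol_def measure_def enn2real_mult)
qed

lemma pvol_hitting_set_scale:
  fixes X Y :: "(real ^ 'n) set"
  assumes "r > 0" and X: "compact X" "X \<noteq> {}" and Y: "compact Y" "Y \<noteq> {}"
  shows "pvol p (hitting_set p ((*\<^sub>R) r ` X) ((*\<^sub>R) r ` Y)) = r ^ (CARD('n) * p) * pvol p (hitting_set p X Y)"
proof -
  have "r *\<^sub>R w \<in> (*\<^sub>R) r ` Y \<longleftrightarrow> w \<in> Y" for w using assms(1) by auto
  then have "{z \<in> space (lborel_power p). (\<lambda>i\<in>{..<p}. r *\<^sub>R z i + 0) \<in> hitting_set p ((*\<^sub>R) r ` X) ((*\<^sub>R) r ` Y)} = hitting_set p X Y"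
    using assms(1) by (auto simp: hitting_set_def space_PiM simp flip: scaleR_add_right)
  then show ?thesis
    using assms by (subst pvol_affine[OF assms(1), of _ _ "\<lambda>_. 0"])
      (auto intro!: hitting_set_measurable compact_scaling)
qed

lemma pvol_hitting_set_translate:
  fixes X Y :: "(real ^ 'n) set"
  assumes X: "compact X" "X \<noteq> {}" and Y: "compact Y" "Y \<noteq> {}"
  shows "pvol p (hitting_set p ((+) c ` X) ((+) d ` Y)) = pvol p (hitting_set p X Y)"
proof -
  have "z + (d + x) \<in> (+) d ` Y \<longleftrightarrow> z + x \<in> Y" for z x
    by (auto simp: image_iff algebra_simps)
  then have "{z \<in> space (lborel_power p). (\<lambda>i\<in>{..<p}. 1 *\<^sub>R z i + (d - c)) \<in> hitting_set p ((+) c ` X) ((+) d ` Y)} = hitting_set p X Y"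
    by (auto simp: hitting_set_def space_PiM)
  then show ?thesis
    using assms by (subst pvol_affine[OF zero_less_one, of _ _ "\<lambda>_. d - c"])
      (auto intro!: hitting_set_measurable compact_translation)
qed

text \<open>Subtracting the last coordinate from the others turns the fibres into Minkowski differences of a fixed
  body with \<open>X\<close>; their dependence on a dilation of \<open>X\<close> is governed by Steiner's formula in \<open>\<real>\<^sup>n\<close>.\<close>

definition common_part :: "nat \<Rightarrow> (real ^ 'n) set \<Rightarrow> (nat \<Rightarrow> real ^ 'n) \<Rightarrow> (real ^ 'n) set" where
  "common_part q Y d = {y \<in> Y. \<forall>i<q. y + d i \<in> Y}"

lemma compact_common_part: "compact Y \<Longrightarrow> compact (common_part q Y d)"
proof -
  assume Y: "compact Y"
  have "(\<lambda>x. x - d i) ` Y = {y. y + d i \<in> Y}" for i by (auto simp: image_iff algebra_simps)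
  then have "closed {y. y + d i \<in> Y}" for i
    using Y by (metis compact_translation_subtract compact_imp_closed)
  then have "closed (\<Inter>i\<in>{..<q}. {y. y + d i \<in> Y})" by blast
  then have "compact (Y \<inter> (\<Inter>i\<in>{..<q}. {y. y + d i \<in> Y}))" using Y by (rule compact_Int_closed[rotated])
  moreover have "Y \<inter> (\<Inter>i\<in>{..<q}. {y. y + d i \<in> Y}) = common_part q Y d" by (auto simp: common_part_def)
  ultimately show ?thesis by simp
qed

lemma convex_common_part:
  assumes "convex Y" shows "convex (common_part q Y d)"
proof (rule convexI)
  fix x y and s t :: real
  assume xy: "x \<in> common_part q Y d" "y \<in> common_part q Y d" and st: "0 \<le> s" "0 \<le> t" "s + t = 1"
  have "s *\<^sub>R x + t *\<^sub>R y + d i = s *\<^sub>R (x + d i) + t *\<^sub>R (y + d i)" for i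
    using st(3) by (simp add: algebra_simps flip: scaleR_add_left)
  then show "s *\<^sub>R x + t *\<^sub>R y \<in> common_part q Y d"
    using xy assms st by (auto simp: common_part_def intro!: convexD)
qed

lemma emeasure_hitting_set_Suc:
  fixes X Y :: "(real ^ 'n) set"
  assumes X: "compact X" "X \<noteq> {}" and Y: "compact Y" "Y \<noteq> {}"
  shows "emeasure (lborel_power (Suc q)) (hitting_set (Suc q) X Y) =
    (\<integral>\<^sup>+ d. emeasure lborel (minkowski_add (common_part q Y d) (-1) X) \<partial>lborel_power q)" (is ?int)
   and "(\<lambda>d. emeasure lborel (minkowski_add (common_part q Y d) (-1) X)) \<in> borel_measurable (lborel_power q)" (is ?meas)
proof -
  let ?H = "hitting_set (Suc q) X Y"
  let ?I = "indicator ?H :: (nat \<Rightarrow> real ^ 'n) \<Rightarrow> ennreal"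
  have H: "?H \<in> sets (lborel_power (Suc q))" using assms by (rule hitting_set_measurable)
  \<comment> \<open>The inverse of the change of variables: \<open>w\<close> is the last coordinate,
    \<open>d i\<close> the difference of coordinate \<open>i\<close> from it. A point
    \<open>x\<close> of \<open>X\<close> witnesses the hit exactly if \<open>w + x\<close> lies in
    the common part.\<close>
  let ?s = "\<lambda>w d. (\<lambda>i\<in>{..<q}. d i + w)(q := w :: real ^ 'n)"
  interpret q: sigma_finite_measure "lborel_power q :: (nat \<Rightarrow> real ^ 'n) measure"
    by (rule lborel_product.sigma_finite) simp
  interpret pair: pair_sigma_finite "lborel_power q :: (nat \<Rightarrow> real ^ 'n) measure" "lborel :: (real ^ 'n) measure" ..
  have s: "(\<lambda>(d, w). ?s w d) \<in> lborel_power q \<Otimes>\<^sub>M lborel \<rightarrow>\<^sub>M lborel_power (Suc q)"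
    unfolding lessThan_Suc case_prod_unfold by measurable
  have mJ: "(\<lambda>(d, w). ?I (?s w d)) \<in> borel_measurable (lborel_power q \<Otimes>\<^sub>M lborel)"
    using measurable_compose[OF s, of ?I borel] H by (simp add: case_prod_unfold)
  have fibre: "(\<integral>\<^sup>+ w. ?I (?s w d) \<partial>lborel) = emeasure lborel (minkowski_add (common_part q Y d) (-1) X)"
    if d: "d \<in> space (lborel_power q)" for d
  proof -
    have "?s w d \<in> ?H \<longleftrightarrow> w \<in> minkowski_add (common_part q Y d) (-1) X" for w
    proof -
      have "?s w d \<in> ?H \<longleftrightarrow> (\<exists>x\<in>X. w + x \<in> Y \<and> (\<forall>i<q. d i + w + x \<in> Y))"
        by (auto simp: hitting_set_def space_PiM PiE_iff extensional_def less_Suc_eq)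
      also have "\<dots> \<longleftrightarrow> (\<exists>x\<in>X. w + x \<in> common_part q Y d)"
        by (simp add: common_part_def algebra_simps)
      also have "\<dots> \<longleftrightarrow> w \<in> minkowski_add (common_part q Y d) (-1) X"
        by (force simp: minkowski_add_def)
      finally show ?thesis .
    qed
    then have "(\<integral>\<^sup>+ w. ?I (?s w d) \<partial>lborel) = (\<integral>\<^sup>+ w. indicator (minkowski_add (common_part q Y d) (-1) X) w \<partial>lborel)"
      by (intro nn_integral_cong) (simp add: indicator_def)
    also have "\<dots> = emeasure lborel (minkowski_add (common_part q Y d) (-1) X)"
      using compact_minkowski_add[OF compact_common_part[OF Y(1)] X(1)]
      by (intro nn_integral_indicator) (simp add: compact_imp_closed)
    finally show ?thesis .
  qed
  \<comment> \<open>For fixed \<open>w\<close> the substitution translates each of the first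
    \<open>q\<close> coordinates by \<open>w\<close>, which preserves the product measure.\<close>
  have shift: "(\<integral>\<^sup>+ z. ?I (z(q := w)) \<partial>lborel_power q) = (\<integral>\<^sup>+ d. ?I (?s w d) \<partial>lborel_power q)" for w
  proof -
    let ?T = "\<lambda>d::nat \<Rightarrow> real ^ 'n. \<lambda>i\<in>{..<q}. 1 *\<^sub>R d i + w"
    have T: "?T \<in> lborel_power q \<rightarrow>\<^sub>M lborel_power q" by measurable
    have "(\<lambda>z. z(q := w)) \<in> lborel_power q \<rightarrow>\<^sub>M lborel_power (Suc q)"
      unfolding lessThan_Suc by measurable
    then have m: "(\<lambda>z. ?I (z(q := w))) \<in> borel_measurable (lborel_power q)"
      using measurable_compose[of _ _ _ ?I borel] H by simp
    have "lborel_power q = distr (lborel_power q) (lborel_power q) ?T"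
      using lborel_power_affine[of 1 q "\<lambda>_. w"] by simp
    then have "(\<integral>\<^sup>+ z. ?I (z(q := w)) \<partial>lborel_power q) = (\<integral>\<^sup>+ z. ?I (z(q := w)) \<partial>distr (lborel_power q) (lborel_power q) ?T)"
      by simp
    also have "\<dots> = (\<integral>\<^sup>+ d. ?I ((?T d)(q := w)) \<partial>lborel_power q)"
      using m by (intro nn_integral_distr[OF T]) simp
    finally show ?thesis by simp
  qed
  have "emeasure (lborel_power (Suc q)) ?H = (\<integral>\<^sup>+ z. ?I z \<partial>lborel_power (Suc q))"
    using H by simp
  also have "\<dots> = (\<integral>\<^sup>+ w. (\<integral>\<^sup>+ z. ?I (z(q := w)) \<partial>lborel_power q) \<partial>lborel)"
    using H unfolding lessThan_Suc by (intro lborel_product.product_nn_integral_insert_rev) auto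
  also have "\<dots> = (\<integral>\<^sup>+ w. (\<integral>\<^sup>+ d. ?I (?s w d) \<partial>lborel_power q) \<partial>lborel)"
    by (simp only: shift)
  also have "\<dots> = (\<integral>\<^sup>+ d. (\<integral>\<^sup>+ w. ?I (?s w d) \<partial>lborel) \<partial>lborel_power q)"
    using pair.Fubini'[OF mJ] by simp
  also have "\<dots> = (\<integral>\<^sup>+ d. emeasure lborel (minkowski_add (common_part q Y d) (-1) X) \<partial>lborel_power q)"
    by (intro nn_integral_cong fibre)
  finally show ?int .
  have "(\<lambda>d. \<integral>\<^sup>+ w. ?I (?s w d) \<partial>lborel) \<in> borel_measurable (lborel_power q)"
    using mJ by (intro lborel.borel_measurable_nn_integral) (simp add: case_prod_unfold)
  then show ?meas by (rule measurable_cong[THEN iffD1, rotated]) (rule fibre)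
qed

text \<open>The factor \<open>a\<close> enters only through the fibres, Minkowski sums in dimension
  \<open>CARD('n)\<close> with \<open>a\<close> times the reflected body. So the degree is at most
  \<open>CARD('n)\<close>, whatever the number of factors, and integration over \<open>d\<close>
  preserves this.\<close>

lemma interpolates_pvol_hitting_set:
  fixes K Y :: "(real ^ 'n) set"
  assumes K: "convex_body K" and Y: "convex_body Y"
  shows "interpolates (CARD('n)) (\<lambda>a. pvol (Suc q) (hitting_set (Suc q) ((*\<^sub>R) a ` K) Y))"
proof -
  let ?F = "\<lambda>a d. measure lborel (minkowski_add (common_part q Y d) a (uminus ` K))"
  have K': "compact K" "K \<noteq> {}" "convex K" and Y': "compact Y" "Y \<noteq> {}" "convex Y"
    using assms by (auto simp: convex_body_def)
  have neg: "minkowski_add A (-1) ((*\<^sub>R) a ` K) = minkowski_add A a (uminus ` K)" for A :: "(real ^ 'n) set" and a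
    by (force simp: minkowski_add_def)
  have "interpolates (CARD('n)) (\<lambda>a. ?F a d)" for d
    using K' Y' by (intro steiner compact_common_part convex_common_part compact_negations convex_negations)
  moreover have "integrable (lborel_power q) (?F a) \<and>
      pvol (Suc q) (hitting_set (Suc q) ((*\<^sub>R) a ` K) Y) = integral\<^sup>L (lborel_power q) (?F a)" for a
  proof -
    have aK: "compact ((*\<^sub>R) a ` K)" "(*\<^sub>R) a ` K \<noteq> {}" using K' by (auto intro: compact_scaling)
    note Suc = emeasure_hitting_set_Suc[OF aK Y'(1,2), of q, unfolded neg]
    have "emeasure lborel (minkowski_add (common_part q Y d) a (uminus ` K)) = ennreal (?F a d)" for d
      using emeasure_compact_finite[OF compact_minkowski_add[OF compact_common_part[OF Y'(1)] compact_negations[OF K'(1)]]]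
      by (intro emeasure_eq_ennreal_measure) (auto simp: less_top)
    note Suc = Suc[unfolded this]
    have fin: "(\<integral>\<^sup>+ d. ennreal (?F a d) \<partial>lborel_power q) < \<infinity>"
      using emeasure_hitting_set_finite[OF aK(1) Y'(1), of "Suc q"] unfolding Suc(1) .
    have meas: "?F a \<in> borel_measurable (lborel_power q)"
      using borel_measurable_enn2real[OF Suc(2)] by simp
    have int: "integrable (lborel_power q) (?F a)"
      by (rule integrableI_nonneg[OF meas _ fin]) auto
    then show ?thesis
      using Suc(1) by (simp add: pvol_def measure_def nn_integral_eq_integral enn2real_ennreal)
  qed
  ultimately show ?thesis
    by (subst interpolates_cong[where g = "\<lambda>a. integral\<^sup>L (lborel_power q) (?F a)"])
       (auto intro!: interpolates_lebesgue_integral)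
qed

subsection \<open>Mixed volumes as coefficients\<close>

lemma dilation_mono:
  fixes K :: "'a::real_vector set"
  assumes "convex K" "0 \<in> K" "0 \<le> r" "r \<le> s"
  shows "(*\<^sub>R) r ` K \<subseteq> (*\<^sub>R) s ` K"
proof (cases "s = 0")
  case False
  show ?thesis
  proof
    fix z assume "z \<in> (*\<^sub>R) r ` K"
    then obtain x where x: "x \<in> K" "z = r *\<^sub>R x" by auto
    have "(r / s) *\<^sub>R x + (1 - r / s) *\<^sub>R 0 \<in> K"
      using assms False x by (intro convexD) (auto simp: field_simps)
    then have "(r / s) *\<^sub>R x \<in> K" by simp
    moreover have "z = s *\<^sub>R ((r / s) *\<^sub>R x)" using x False by simp
    ultimately show "z \<in> (*\<^sub>R) s ` K" by (rule rev_image_eqI)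
  qed
qed (use assms in auto)

lemma INT_dilation:
  fixes K :: "'a::real_normed_vector set"
  assumes "convex K" "compact K" "0 \<in> K" "0 \<le> a"
  shows "(\<Inter>m::nat. (*\<^sub>R) (a + 1 / (real m + 1)) ` K) = (*\<^sub>R) a ` K"
proof (intro equalityI subsetI)
  fix z assume "z \<in> (\<Inter>m::nat. (*\<^sub>R) (a + 1 / (real m + 1)) ` K)"
  then have "\<forall>m::nat. \<exists>x. x \<in> K \<and> z = (a + 1 / (real m + 1)) *\<^sub>R x" by blast
  from choice[OF this] obtain x where x: "\<And>m::nat. x m \<in> K" "\<And>m. z = (a + 1 / (real m + 1)) *\<^sub>R x m" by blast
  obtain l r where l: "l \<in> K" and r: "strict_mono r" "(x \<circ> r) \<longlonglongrightarrow> l"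
    using assms(2) x(1) unfolding compact_def by meson
  have "(\<lambda>m. 1 / (real m + 1)) \<longlonglongrightarrow> 0"
    using LIMSEQ_Suc[OF lim_1_over_n[where 'a=real]] by (simp add: add.commute)
  from LIMSEQ_subseq_LIMSEQ[OF this r(1)] have "(\<lambda>m. 1 / (real (r m) + 1)) \<longlonglongrightarrow> 0" by (simp add: o_def)
  then have "(\<lambda>m. (a + 1 / (real (r m) + 1)) *\<^sub>R (x \<circ> r) m) \<longlonglongrightarrow> (a + 0) *\<^sub>R l"
    by (intro tendsto_intros r)
  moreover have "(a + 1 / (real (r m) + 1)) *\<^sub>R (x \<circ> r) m = z" for m using x(2)[of "r m"] by simp
  ultimately have "z = a *\<^sub>R l" by (simp add: LIMSEQ_const_iff)
  then show "z \<in> (*\<^sub>R) a ` K" using l by auto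
next
  fix z assume z: "z \<in> (*\<^sub>R) a ` K"
  have "(*\<^sub>R) a ` K \<subseteq> (*\<^sub>R) (a + 1 / (real m + 1)) ` K" for m :: nat
    using assms by (intro dilation_mono) auto
  then show "z \<in> (\<Inter>m::nat. (*\<^sub>R) (a + 1 / (real m + 1)) ` K)" using z by blast
qed

text \<open>For positive factors homogeneity reduces to \<open>b = 1\<close>, where Steiner's
  formula gives a polynomial in \<open>a / b\<close>. The case of a zero factor is a limit from
  above.\<close>

lemma pvol_hitting_set_polynomial:
  fixes K :: "(real ^ 'n) set"
  assumes K: "convex_body K" and p: "p \<ge> 1"
  shows "\<exists>c. \<forall>a\<ge>0. \<forall>b\<ge>0. pvol p (hitting_set p ((*\<^sub>R) a ` K) ((*\<^sub>R) b ` K)) =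
    (\<Sum>j\<le>CARD('n). real ((CARD('n) * p) choose j) * c j * a ^ j * b ^ (CARD('n) * p - j))"
proof -
  let ?N = "CARD('n) * p"
  let ?g = "\<lambda>K a b. pvol p (hitting_set p ((*\<^sub>R) a ` K) ((*\<^sub>R) b ` (K :: (real ^ 'n) set)))"
  have N: "CARD('n) \<le> ?N" using p by simp
  have K': "compact K" "convex K" "K \<noteq> {}" using K by (auto simp: convex_body_def)
  obtain q where q: "p = Suc q" using p by (cases p) auto
  obtain c where c: "\<And>a. a > 0 \<Longrightarrow> pvol p (hitting_set p ((*\<^sub>R) a ` K) K) = (\<Sum>j\<le>CARD('n). c j * a ^ j)"
    using interpolates_coeffs[OF interpolates_pvol_hitting_set[OF K K, of q]] unfolding q by blast
  \<comment> \<open>Dividing by the binomial coefficient makes \<open>C j\<close> the mixed volume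
    itself, as \<open>diag_mixed_volume_eq\<close> confirms.\<close>
  define C where "C j = c j / real (?N choose j)" for j
  define P where "P a b = (\<Sum>j\<le>CARD('n). real (?N choose j) * C j * a ^ j * b ^ (?N - j))" for a b
  have pos: "?g K a b = P a b" if a: "a > 0" and b: "b > 0" for a b
  proof -
    have "?g K a b = pvol p (hitting_set p ((*\<^sub>R) b ` (*\<^sub>R) (a / b) ` K) ((*\<^sub>R) b ` K))"
      using b by (simp add: image_image)
    also have "\<dots> = b ^ ?N * (\<Sum>j\<le>CARD('n). c j * (a / b) ^ j)"
      using K' a b by (subst pvol_hitting_set_scale) (auto intro: compact_scaling simp: c)
    also have "\<dots> = P a b"
      unfolding P_def sum_distrib_left
    proof (intro sum.cong refl)
      fix j assume "j \<in> {..CARD('n)}"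
      then have j: "j \<le> ?N" using order_trans[OF _ N] by blast
      then have "b ^ ?N = b ^ j * b ^ (?N - j)" by (simp flip: power_add)
      then show "b ^ ?N * (c j * (a / b) ^ j) = real (?N choose j) * C j * a ^ j * b ^ (?N - j)"
        using b j by (simp add: C_def power_divide)
    qed
    finally show ?thesis .
  qed
  have "?g K a b = P a b" if a: "a \<ge> 0" and b: "b \<ge> 0" for a b
  proof -
    \<comment> \<open>Dilates are nested only if the body contains the origin. Hence
      \<open>K\<close> is translated by \<open>- k\<close>, which leaves the volumes of the hitting
      sets unchanged.\<close>
    obtain k where k: "k \<in> K" using K' by auto
    define K0 where "K0 = (+) (- k) ` K"
    have K0: "compact K0" "convex K0"
      unfolding K0_def by (rule compact_translation[OF K'(1)], rule convex_translation[OF K'(2)])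
    have K0_0: "0 \<in> K0" using k unfolding K0_def by (rule rev_image_eqI) simp
    note K0 = K0 K0_0
    have K0_dil: "(*\<^sub>R) r ` K0 = (+) (- (r *\<^sub>R k)) ` (*\<^sub>R) r ` K" for r
      by (simp add: K0_def image_image scaleR_diff_right)
    have tr: "?g K0 a b = ?g K a b" for a b
      unfolding K0_dil by (rule pvol_hitting_set_translate) (use K' in \<open>auto intro: compact_scaling\<close>)
    have dec: "decseq (\<lambda>m. (*\<^sub>R) (r + 1 / (real m + 1)) ` K0)" if "r \<ge> 0" for r
      unfolding decseq_def using that K0 by (intro allI impI dilation_mono) (auto simp: field_simps)
    have "(\<lambda>m. ?g K0 (a + 1 / (real m + 1)) (b + 1 / (real m + 1))) \<longlonglongrightarrow> ?g K0 a b"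
      using pvol_hitting_set_decseq[of "\<lambda>m. (*\<^sub>R) (a + 1 / (real m + 1)) ` K0" "\<lambda>m. (*\<^sub>R) (b + 1 / (real m + 1)) ` K0" p]
        dec[OF a] dec[OF b] K0 a b by (auto simp: INT_dilation compact_scaling)
    moreover have "?g K0 (a + 1 / (real m + 1)) (b + 1 / (real m + 1)) = P (a + 1 / (real m + 1)) (b + 1 / (real m + 1))" for m
      unfolding tr using a b by (intro pos add_nonneg_pos) auto
    ultimately have "(\<lambda>m. P (a + 1 / (real m + 1)) (b + 1 / (real m + 1))) \<longlonglongrightarrow> ?g K a b"
      by (simp add: tr)
    moreover have "(\<lambda>m. P (a + 1 / (real m + 1)) (b + 1 / (real m + 1))) \<longlonglongrightarrow> P (a + 0) (b + 0)"
    proof -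
      have "(\<lambda>m. 1 / (real m + 1)) \<longlonglongrightarrow> 0"
        using LIMSEQ_Suc[OF lim_1_over_n[where 'a=real]] by (simp add: add.commute)
      then show ?thesis unfolding P_def by (intro tendsto_intros)
    qed
    ultimately show ?thesis using LIMSEQ_unique by fastforce
  qed
  then show ?thesis unfolding P_def by blast
qed

section \<open>Iterated one-sided derivatives of a form in two sums of variables\<close>

definition falling :: "nat \<Rightarrow> nat \<Rightarrow> real" where
  "falling q r = (\<Prod>l<r. real (q - l))"

lemma falling_Suc: "falling q (Suc r) = falling q r * real (q - r)"
  by (simp add: falling_def)

lemma falling_eq_0: "q < r \<Longrightarrow> falling q r = 0"
  by (auto simp: falling_def intro: prod_zero)

lemma falling_self: "falling q q = fact q"
  by (simp add: falling_def fact_prod_rev atLeast0LessThan)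

text \<open>The volume agrees with a polynomial \<open>g\<close> only on nonnegative arguments;
  there its one-sided derivative is the ordinary derivative of \<open>g\<close>.\<close>

lemma partial_nonneg_cong:
  assumes "\<And>t. (\<And>l. t l \<ge> 0) \<Longrightarrow> f t = g t" "\<And>l. t l \<ge> 0"
    and "((\<lambda>s. g (t(k := s))) has_real_derivative D) (at (t k))"
  shows "partial_nonneg k f t = D"
proof -
  have "((\<lambda>s. g (t(k := s))) has_vector_derivative D) (at (t k) within {0..})"
    using assms(3) by (simp add: has_real_derivative_iff_has_vector_derivative has_vector_derivative_at_within)
  then have "((\<lambda>s. f (t(k := s))) has_vector_derivative D) (at (t k) within {0..})"
    by (rule has_vector_derivative_transform[rotated 2]) (use assms(1,2) in auto)
  \<comment> \<open>The derivative within the half-line is unique because \<open>t k\<close> is not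
    isolated in it, even at the endpoint.\<close>
  moreover have "at_right (t k) \<le> at (t k) within {0..}"
    using assms(2)[of k] by (intro at_le) auto
  then have "at (t k) within {0..} \<noteq> bot" using trivial_limit_at_right_real[of "t k"] le_bot by metis
  ultimately show ?thesis unfolding partial_nonneg_def by (intro vector_derivative_within)
qed

text \<open>\<open>F j r s\<close> is the form after \<open>s\<close> derivatives in variables below
  \<open>j\<close> and \<open>r\<close> in the others; each derivative lowers an exponent and
  extends a falling factorial. \<open>foldr\<close> treats index \<open>N - 1\<close> first, so the
  induction descends on \<open>m\<close>. \<open>N - max j m\<close> and the truncated
  \<open>j - m\<close> count the two kinds of variables in \<open>{m..<N}\<close>.\<close>

lemma iterated_partial_nonneg:
  fixes c :: "nat \<Rightarrow> real" and n N :: nat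
  defines "F \<equiv> \<lambda>j r s (t :: nat \<Rightarrow> real). \<Sum>i\<le>n. c i * falling i s * falling (N - i) r *
      (\<Sum>k<j. t k) ^ (i - s) * (\<Sum>k\<in>{j..<N}. t k) ^ (N - i - r)"
  assumes f: "\<And>t. (\<And>l. t l \<ge> 0) \<Longrightarrow> f t = F j 0 0 t" and "m \<le> N" "j \<le> N" and t: "\<And>l. t l \<ge> 0"
  shows "foldr partial_nonneg [m..<N] f t = F j (N - max j m) (j - m) t"
  using \<open>m \<le> N\<close> t
proof (induction m arbitrary: t rule: inc_induct)
  case base
  then show ?case using f \<open>j \<le> N\<close> by simp
next
  case (step m)
  show ?case
  proof (cases "j \<le> m")
    case True
    let ?\<beta> = "\<Sum>k\<in>{j..<N} - {m}. t k"
    have sB: "(\<Sum>k\<in>{j..<N}. (t(m := x)) k) = x + ?\<beta>" for x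
      using True step.hyps by (subst sum.remove[of _ m]) (auto intro!: sum.cong)
    have sA: "(\<Sum>k<j. (t(m := x)) k) = (\<Sum>k<j. t k)" for x
      using True by (intro sum.cong) auto
    have tB: "t m + ?\<beta> = (\<Sum>k\<in>{j..<N}. t k)" using sB[of "t m"] by simp
    have r: "N - max j m = Suc (N - Suc m)" "N - max j (Suc m) = N - Suc m" "j - Suc m = 0" "j - m = 0"
      using True step.hyps by auto
    have "((\<lambda>x. F j (N - Suc m) 0 (t(m := x))) has_real_derivative F j (Suc (N - Suc m)) 0 t) (at (t m))"
      unfolding F_def sA sB
      by (auto intro!: derivative_eq_intros sum.cong simp: falling_Suc tB)
    then show ?thesis
      using step partial_nonneg_cong[of "foldr partial_nonneg [Suc m..<N] f" "F j (N - Suc m) 0" t m]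
      by (simp add: upt_conv_Cons r)
  next
    case False
    let ?\<alpha> = "\<Sum>k\<in>{..<j} - {m}. t k"
    have sA: "(\<Sum>k<j. (t(m := x)) k) = x + ?\<alpha>" for x
      using False step.hyps by (subst sum.remove[of _ m]) (auto intro!: sum.cong)
    have sB: "(\<Sum>k\<in>{j..<N}. (t(m := x)) k) = (\<Sum>k\<in>{j..<N}. t k)" for x
      using False by (intro sum.cong) auto
    have tA: "t m + ?\<alpha> = (\<Sum>k<j. t k)" using sA[of "t m"] by simp
    have r: "N - max j m = N - j" "N - max j (Suc m) = N - j" "j - m = Suc (j - Suc m)"
      using False step.hyps by auto
    have "((\<lambda>x. F j (N - j) (j - Suc m) (t(m := x))) has_real_derivative F j (N - j) (Suc (j - Suc m)) t) (at (t m))"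
      unfolding F_def sA sB
      by (auto intro!: derivative_eq_intros sum.cong simp: falling_Suc tA)
    then show ?thesis
      using step partial_nonneg_cong[of "foldr partial_nonneg [Suc m..<N] f" "F j (N - j) (j - Suc m)" t m]
      by (simp add: upt_conv_Cons r)
  qed
qed

lemma weighted_sum_in_dilation:
  fixes K :: "'a::real_vector set"
  assumes "convex K" "K \<noteq> {}" "finite A" "\<And>k. k \<in> A \<Longrightarrow> t k \<ge> 0" "\<And>k. k \<in> A \<Longrightarrow> x k \<in> K"
  shows "(\<Sum>k\<in>A. t k *\<^sub>R x k) \<in> (*\<^sub>R) (sum t A) ` K"
proof (cases "sum t A = 0")
  case True
  then have "\<forall>k\<in>A. t k = 0" using assms(3,4) by (simp add: sum_nonneg_eq_0_iff)
  then have "(\<Sum>k\<in>A. t k *\<^sub>R x k) = 0" by (simp add: sum.neutral)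
  then show ?thesis using True assms(2) by auto
next
  case False
  have "(\<Sum>k\<in>A. (t k / sum t A) *\<^sub>R x k) \<in> K"
    using assms False by (intro convex_sum) (auto simp: sum_nonneg simp flip: sum_divide_distrib)
  moreover have "(\<Sum>k\<in>A. t k *\<^sub>R x k) = sum t A *\<^sub>R (\<Sum>k\<in>A. (t k / sum t A) *\<^sub>R x k)"
    using False by (simp add: scaleR_sum_right)
  ultimately show ?thesis by blast
qed

text \<open>By convexity nonnegative multiples of one body add up, so the N-fold combination depends
  on two sums of coefficients only. Conversely, a point of the hitting set is represented by
  repeating the same \<open>x\<close> in the first \<open>j\<close> slots and the same
  \<open>y\<close> in the rest.\<close>

lemma minkowski_comb_eq_hitting_set:
  fixes K :: "(real ^ 'n) set"
  assumes K: "convex K" "K \<noteq> {}" and t: "\<And>k. t k \<ge> 0" and "j \<le> N"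
  shows "minkowski_comb p N t (\<lambda>k. if k < j then neg_set p (diag_emb p ` K) else set_power p K) =
    hitting_set p ((*\<^sub>R) (\<Sum>k<j. t k) ` K) ((*\<^sub>R) (\<Sum>k\<in>{j..<N}. t k) ` K)" (is "?L = ?R")
proof (intro equalityI subsetI)
  have split: "(\<Sum>k<N. f k) = (\<Sum>k<j. f k) + (\<Sum>k\<in>{j..<N}. f k)" for f :: "nat \<Rightarrow> real ^ 'n"
    using assms(4) by (simp add: sum.atLeastLessThan_concat atLeast0LessThan[symmetric])
  {
    fix z assume "z \<in> ?L"
    then obtain x where x: "\<And>k. k < N \<Longrightarrow> x k \<in> (if k < j then neg_set p (diag_emb p ` K) else set_power p K)"
      and z: "z = (\<lambda>i\<in>{..<p}. \<Sum>k<N. t k *\<^sub>R x k i)"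
      by (auto simp: minkowski_comb_def)
    have "\<exists>u. k < j \<longrightarrow> u \<in> K \<and> (\<forall>i<p. x k i = - u)" for k
      using x[of k] assms(4) by (auto simp: neg_set_def diag_emb_def) blast
    then obtain u where u: "\<And>k. k < j \<Longrightarrow> u k \<in> K" "\<And>k i. k < j \<Longrightarrow> i < p \<Longrightarrow> x k i = - u k"
      by metis
    have y: "x k i \<in> K" if "k \<in> {j..<N}" "i < p" for k i
      using x[of k] that by (auto simp: set_power_def PiE_iff)
    have "(\<Sum>k<j. t k *\<^sub>R u k) \<in> (*\<^sub>R) (\<Sum>k<j. t k) ` K"
      using K t u by (intro weighted_sum_in_dilation) auto
    moreover have "z i + (\<Sum>k<j. t k *\<^sub>R u k) \<in> (*\<^sub>R) (\<Sum>k\<in>{j..<N}. t k) ` K" if "i < p" for i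
    proof -
      have "z i + (\<Sum>k<j. t k *\<^sub>R u k) = (\<Sum>k\<in>{j..<N}. t k *\<^sub>R x k i)"
        using that u(2) by (simp add: z split sum_negf)
      then show ?thesis using K t y that by (auto intro!: weighted_sum_in_dilation)
    qed
    moreover have "z \<in> space (lborel_power p)" by (simp add: z space_PiM)
    ultimately show "z \<in> ?R" unfolding hitting_set_def by blast
  }
  fix z assume "z \<in> ?R"
  then obtain x where x: "x \<in> K" "z \<in> extensional {..<p}"
     "\<And>i. i < p \<Longrightarrow> z i + (\<Sum>k<j. t k) *\<^sub>R x \<in> (*\<^sub>R) (\<Sum>k\<in>{j..<N}. t k) ` K"
    by (auto simp: hitting_set_def space_PiM PiE_iff)
  then have "\<forall>i. \<exists>y. i < p \<longrightarrow> y \<in> K \<and> z i + (\<Sum>k<j. t k) *\<^sub>R x = (\<Sum>k\<in>{j..<N}. t k) *\<^sub>R y" by blast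
  from choice[OF this] obtain y where y: "\<And>i. i < p \<Longrightarrow> y i \<in> K"
     "\<And>i. i < p \<Longrightarrow> z i + (\<Sum>k<j. t k) *\<^sub>R x = (\<Sum>k\<in>{j..<N}. t k) *\<^sub>R y i" by blast
  define X where "X k = (if k < j then (\<lambda>i\<in>{..<p}. - diag_emb p x i) else (\<lambda>i\<in>{..<p}. y i))" for k
  have "X k \<in> (if k < j then neg_set p (diag_emb p ` K) else set_power p K)" for k
    using x(1) y(1) by (auto simp: X_def neg_set_def set_power_def)
  moreover have "z = (\<lambda>i\<in>{..<p}. \<Sum>k<N. t k *\<^sub>R X k i)"
  proof (rule extensionalityI[OF x(2)])
    fix i assume i: "i \<in> {..<p}"
    have "(\<Sum>k<N. t k *\<^sub>R X k i) = - ((\<Sum>k<j. t k) *\<^sub>R x) + (\<Sum>k\<in>{j..<N}. t k) *\<^sub>R y i"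
      using i by (simp add: split X_def diag_emb_def scaleR_sum_left sum_negf)
    also have "\<dots> = z i" using y(2)[of i] i by (simp add: algebra_simps)
    finally show "z i = (\<lambda>i\<in>{..<p}. \<Sum>k<N. t k *\<^sub>R X k i) i" using i by simp
  qed simp
  ultimately show "z \<in> ?L" unfolding minkowski_comb_def by blast
qed

lemma diff_body_eq_hitting_set:
  fixes K :: "(real ^ 'n) set"
  shows "diff_body p t K = hitting_set p ((*\<^sub>R) t ` K) ((*\<^sub>R) (1 - t) ` K)" (is "?L = ?R")
proof (intro equalityI subsetI)
  fix z assume "z \<in> ?R"
  then obtain x where x: "x \<in> K" "z \<in> extensional {..<p}" "\<And>i. i < p \<Longrightarrow> z i + t *\<^sub>R x \<in> (*\<^sub>R) (1 - t) ` K"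
    by (auto simp: hitting_set_def space_PiM PiE_iff)
  then have "\<forall>i. \<exists>y. i < p \<longrightarrow> y \<in> K \<and> z i + t *\<^sub>R x = (1 - t) *\<^sub>R y" by blast
  from choice[OF this] obtain y where y: "\<And>i. i < p \<Longrightarrow> y i \<in> K" "\<And>i. i < p \<Longrightarrow> z i + t *\<^sub>R x = (1 - t) *\<^sub>R y i"
    by blast
  have "z i = (1 - t) *\<^sub>R y i - t *\<^sub>R x" if "i < p" for i
    using y(2)[OF that] by (metis add_diff_cancel_right')
  then have "z = (\<lambda>i\<in>{..<p}. (1 - t) *\<^sub>R (\<lambda>i\<in>{..<p}. y i) i - t *\<^sub>R diag_emb p x i)"
    by (intro extensionalityI[OF x(2)]) (auto simp: diag_emb_def)
  moreover have "(\<lambda>i\<in>{..<p}. y i) \<in> set_power p K" using y(1) by (auto simp: set_power_def)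
  ultimately show "z \<in> ?L" using x(1) unfolding diff_body_def by blast
next
  fix z assume "z \<in> ?L"
  then obtain x y where xy: "x \<in> K" "y \<in> set_power p K" "z = (\<lambda>i\<in>{..<p}. (1 - t) *\<^sub>R y i - t *\<^sub>R diag_emb p x i)"
    by (auto simp: diff_body_def)
  then have "\<forall>i<p. z i + t *\<^sub>R x \<in> (*\<^sub>R) (1 - t) ` K"
    by (auto simp: diag_emb_def set_power_def)
  then show "z \<in> ?R" using xy by (auto simp: hitting_set_def space_PiM)
qed

text \<open>At the origin only the term \<open>i = j\<close> survives the \<open>j\<close> and
  \<open>N - j\<close> derivatives. For \<open>i < j\<close> or \<open>i > j\<close> one of the
  falling factorials is zero; for \<open>i = j\<close> both powers are \<open>0 ^ 0 = 1\<close>. The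
  remaining \<open>fact j * fact (N - j)\<close> combines with the binomial coefficient to
  \<open>fact N\<close>.\<close>

lemma diag_mixed_volume_eq:
  fixes K :: "(real ^ 'n) set"
  assumes K: "convex_body K" and p: "p \<ge> 1" and j: "j \<le> CARD('n)"
   and c: "\<And>a b. a \<ge> 0 \<Longrightarrow> b \<ge> 0 \<Longrightarrow> pvol p (hitting_set p ((*\<^sub>R) a ` K) ((*\<^sub>R) b ` K)) =
    (\<Sum>j\<le>CARD('n). real ((CARD('n) * p) choose j) * c j * a ^ j * b ^ (CARD('n) * p - j))"
  shows "diag_mixed_volume p j K = c j"
proof -
  let ?N = "CARD('n) * p"
  let ?f = "\<lambda>t. pvol p (minkowski_comb p ?N t (\<lambda>k. if k < j then neg_set p (diag_emb p ` K) else set_power p K))"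
  have "CARD('n) \<le> ?N" using p by simp
  then have jN: "j \<le> ?N" using j by linarith
  have f: "?f t = (\<Sum>i\<le>CARD('n). (real (?N choose i) * c i) * falling i 0 * falling (?N - i) 0 *
      (\<Sum>k<j. t k) ^ (i - 0) * (\<Sum>k\<in>{j..<?N}. t k) ^ (?N - i - 0))" if "\<And>l. t l \<ge> 0" for t
    using that K jN by (subst minkowski_comb_eq_hitting_set) (auto simp: convex_body_def c sum_nonneg falling_def)
  have "foldr partial_nonneg [0..<?N] ?f (\<lambda>_. 0) =
    (\<Sum>i\<le>CARD('n). (real (?N choose i) * c i) * falling i j * falling (?N - i) (?N - j) * 0 ^ (i - j) * 0 ^ (?N - i - (?N - j)))"
    using iterated_partial_nonneg[where f = ?f and n = "CARD('n)" and c = "\<lambda>i. real (?N choose i) * c i"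
        and N = ?N and j = j and m = 0 and t = "\<lambda>_. 0"] f jN by simp
  also have "\<dots> = (\<Sum>i\<le>CARD('n). if i = j then real (?N choose j) * c j * fact j * fact (?N - j) else 0)"
  proof (intro sum.cong refl)
    fix i assume "i \<in> {..CARD('n)}"
    then have i: "i \<le> ?N" using order_trans[OF _ \<open>CARD('n) \<le> ?N\<close>] by blast
    consider "i < j" | "i = j" | "i > j" by linarith
    then show "(real (?N choose i) * c i) * falling i j * falling (?N - i) (?N - j) * 0 ^ (i - j) * 0 ^ (?N - i - (?N - j)) =
       (if i = j then real (?N choose j) * c j * fact j * fact (?N - j) else 0)"
    proof cases
      case 3
      then have "falling (?N - i) (?N - j) = 0" using i by (intro falling_eq_0) linarith
      then show ?thesis using 3 by simp
    qed (auto simp: falling_eq_0 falling_self)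
  qed
  also have "\<dots> = c j * (fact j * fact (?N - j) * real (?N choose j))" using j by (simp add: mult_ac)
  also have "fact j * fact (?N - j) * real (?N choose j) = fact ?N"
    using binomial_fact_lemma[OF jN] by (metis of_nat_fact of_nat_mult)
  finally show ?thesis
    by (simp add: diag_mixed_volume_def mixed_volume_def Let_def)
qed

subsection \<open>Simplices\<close>

text \<open>Integration by parts: the primitive \<open>?F\<close> vanishes at both ends and trades a
  factor \<open>a - r\<close> for a factor \<open>r\<close>, which is why \<open>k\<close> is
  arbitrary in the induction.\<close>

lemma beta_integral_nat:
  fixes a :: real
  assumes "a \<ge> 0"
  shows "((\<lambda>r. r ^ k * (a - r) ^ m) has_integral fact k * fact m / fact (k + m + 1) * a ^ (k + m + 1)) {0..a}"
proof (induction m arbitrary: k)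
  case 0
  have "((\<lambda>r. r ^ Suc k / (real k + 1)) has_real_derivative r ^ k) (at r within {0..a})" for r
    using DERIV_cdivide[OF DERIV_pow[of "Suc k" r "{0..a}"], of "real k + 1"] by (simp add: add.commute)
  then have "((\<lambda>r. r ^ k) has_integral a ^ Suc k / (real k + 1) - 0 ^ Suc k / (real k + 1)) {0..a}"
    using assms
    by (intro fundamental_theorem_of_calculus) (simp_all flip: has_real_derivative_iff_has_vector_derivative)
  moreover have "fact k * fact 0 / fact (k + 0 + 1) * a ^ (k + 0 + 1) = a ^ Suc k / (real k + 1)"
    by (simp add: add.commute)
  ultimately show ?case by (simp add: add.commute)
next
  case (Suc m)
  let ?F = "\<lambda>r. r ^ Suc k * (a - r) ^ Suc m / (1 + real k)"
  let ?X = "\<lambda>r. r ^ k * (a - r) ^ Suc m" and ?Y = "\<lambda>r. r ^ Suc k * (a - r) ^ m"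
  have "(?F has_real_derivative ?X r - (1 + real m) / (1 + real k) * ?Y r) (at r within {0..a})" for r
  proof -
    have "(?F has_real_derivative (r ^ Suc k * ((1 + real m) * ((0 - 1) * (a - r) ^ m)) +
        (1 + real k) * (1 * r ^ k) * (a - r) ^ Suc m) / (1 + real k)) (at r within {0..a})"
      by (intro DERIV_cdivide DERIV_mult' DERIV_power_Suc DERIV_diff DERIV_const DERIV_ident)
    moreover have "r ^ Suc k * ((1 + real m) * ((0 - 1) * (a - r) ^ m)) + (1 + real k) * (1 * r ^ k) * (a - r) ^ Suc m =
        (1 + real k) * ?X r - (1 + real m) * ?Y r"
      by (simp add: algebra_simps)
    ultimately show ?thesis by (simp add: diff_divide_distrib mult.left_commute del: power_Suc)
  qed
  then have "((\<lambda>r. ?X r - (1 + real m) / (1 + real k) * ?Y r) has_integral ?F a - ?F 0) {0..a}"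
    using assms
    by (intro fundamental_theorem_of_calculus) (simp_all flip: has_real_derivative_iff_has_vector_derivative del: power_Suc)
  from has_integral_add[OF this has_integral_mult_right[OF Suc.IH[of "Suc k"], of "(1 + real m) / (1 + real k)"]]
  have int: "(?X has_integral (1 + real m) / (1 + real k) *
      (fact (Suc k) * fact m / fact (Suc k + m + 1) * a ^ (Suc k + m + 1))) {0..a}"
    by simp
  have "(1 + real m) / (1 + real k) * (((1 + real k) * x) * y / Q * A) = x * ((1 + real m) * y) / Q * A" for x y Q A :: real
    by simp
  from this[of "fact k" "fact m" "fact (k + Suc m + 1)" "a ^ (k + Suc m + 1)"]
  have eq: "(1 + real m) / (1 + real k) * (fact (Suc k) * fact m / fact (Suc k + m + 1) * a ^ (Suc k + m + 1)) =
      fact k * fact (Suc m) / fact (k + Suc m + 1) * a ^ (k + Suc m + 1)"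
    by (simp only: fact_Suc of_nat_Suc add_Suc add_Suc_right)
  show ?case using int unfolding eq .
qed

text \<open>Convolution with \<open>n * r ^ (n - 1)\<close> sends each monomial to a multiple of a
  monomial. This operator occurs in the integral equation for simplices, and the binomial
  coefficients are what must be inverted.\<close>

lemma simplex_kernel_integral:
  fixes a :: real
  assumes "a \<ge> 0" "n \<ge> 1"
  shows "((\<lambda>r. real n * r ^ (n - 1) * (a - r) ^ m) has_integral a ^ (n + m) / real ((n + m) choose n)) {0..a}"
proof -
  have "((\<lambda>r. real n * (r ^ (n - 1) * (a - r) ^ m)) has_integral
      real n * (fact (n - 1) * fact m / fact (n - 1 + m + 1) * a ^ (n - 1 + m + 1))) {0..a}"
    by (intro has_integral_mult_right beta_integral_nat assms)
  moreover have "real n * (fact (n - 1) * fact m / fact (n - 1 + m + 1) * a ^ (n - 1 + m + 1)) = a ^ (n + m) / real ((n + m) choose n)"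
    using assms(2) by (simp add: binomial_fact fact_reduce[of n] mult_ac)
  ultimately show ?thesis by (simp add: mult.assoc)
qed

text \<open>The right-hand side is, up to a constant factor, the solution forced by the integral
  equation; the left-hand side is the volume polynomial at \<open>b = a + 1\<close> with the
  conjectured coefficients. Expanding \<open>(a + 1) ^ (N - j)\<close> and collecting powers leaves
  a Vandermonde sum.\<close>

lemma binomial_convolution:
  fixes a :: real
  shows "(\<Sum>j\<le>n. real (N choose j) * real (n choose j) * a ^ j * (a + 1) ^ (N - j)) =
    (\<Sum>m\<le>N. real (N choose m) * real ((n + m) choose n) * a ^ m)"
proof -
  have "(\<Sum>j\<le>n. real (N choose j) * real (n choose j) * a ^ j * (a + 1) ^ (N - j)) =
     (\<Sum>j\<le>N. real (N choose j) * real (n choose j) * a ^ j * (a + 1) ^ (N - j))"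
    by (rule sum.mono_neutral_cong) (auto simp: binomial_eq_0)
  also have "\<dots> = (\<Sum>j\<le>N. \<Sum>m\<in>{j..N}. real (N choose m) * (real (m choose j) * real (n choose j)) * a ^ m)"
  proof (intro sum.cong refl)
    fix j assume j: "j \<in> {..N}"
    have "(a + 1) ^ (N - j) = (\<Sum>k\<le>N - j. real ((N - j) choose k) * a ^ k)"
      by (simp add: binomial_ring)
    then have "real (N choose j) * real (n choose j) * a ^ j * (a + 1) ^ (N - j) =
      (\<Sum>k\<le>N - j. real (N choose j) * real (n choose j) * a ^ j * (real ((N - j) choose k) * a ^ k))"
      by (simp add: sum_distrib_left)
    also have "\<dots> = (\<Sum>m\<in>{j..N}. real (N choose j) * real (n choose j) * a ^ j * (real ((N - j) choose (m - j)) * a ^ (m - j)))"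
      using j by (intro sum.reindex_bij_witness[of _ "\<lambda>m. m - j" "\<lambda>k. k + j"]) auto
    also have "\<dots> = (\<Sum>m\<in>{j..N}. real (N choose m) * (real (m choose j) * real (n choose j)) * a ^ m)"
    proof (intro sum.cong refl)
      fix m assume m: "m \<in> {j..N}"
      have "(N choose m) * (m choose j) = (N choose j) * ((N - j) choose (m - j))"
        using m by (intro choose_mult) auto
      then have "real (N choose m) * real (m choose j) = real (N choose j) * real ((N - j) choose (m - j))"
        by (metis of_nat_mult)
      moreover have "a ^ m = a ^ j * a ^ (m - j)" using m by (simp flip: power_add)
      ultimately show "real (N choose j) * real (n choose j) * a ^ j * (real ((N - j) choose (m - j)) * a ^ (m - j)) =
          real (N choose m) * (real (m choose j) * real (n choose j)) * a ^ m"
        by (simp add: mult_ac)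
    qed
    finally show "real (N choose j) * real (n choose j) * a ^ j * (a + 1) ^ (N - j) =
       (\<Sum>m\<in>{j..N}. real (N choose m) * (real (m choose j) * real (n choose j)) * a ^ m)" .
  qed
  also have "\<dots> = (\<Sum>m\<le>N. \<Sum>j\<le>m. real (N choose m) * (real (m choose j) * real (n choose j)) * a ^ m)"
    unfolding sum.Sigma[OF finite_atMost ballI, OF finite_atLeastAtMost] sum.Sigma[OF finite_atMost ballI, OF finite_atMost]
    by (rule sum.reindex_bij_witness[of _ "\<lambda>(m, j). (j, m)" "\<lambda>(j, m). (m, j)"]) auto
  also have "\<dots> = (\<Sum>m\<le>N. real (N choose m) * real ((n + m) choose n) * a ^ m)"
  proof (intro sum.cong refl)
    fix m
    have "(\<Sum>j\<le>m. (m choose j) * (n choose j)) = (\<Sum>j\<le>m. (n choose j) * (m choose (m - j)))"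
      by (intro sum.cong) (auto simp: binomial_symmetric[symmetric] mult.commute)
    also have "\<dots> = (n + m) choose m" by (rule vandermonde)
    also have "\<dots> = (n + m) choose n" by (metis binomial_symmetric diff_add_inverse2 le_add2)
    finally have "(\<Sum>j\<le>m. real (m choose j) * real (n choose j)) = real ((n + m) choose n)"
      by (metis (mono_tags, lifting) of_nat_mult of_nat_sum sum.cong)
    then show "(\<Sum>j\<le>m. real (N choose m) * (real (m choose j) * real (n choose j)) * a ^ m) =
       real (N choose m) * real ((n + m) choose n) * a ^ m"
      by (simp flip: sum_distrib_left sum_distrib_right)
  qed
  finally show ?thesis .
qed

text \<open>\<open>L v x + l v\<close> is the barycentric coordinate of \<open>x\<close> at the
  vertex \<open>v\<close>. Linear part and constant are kept apart because dilation by
  \<open>r\<close> multiplies only the constant in the facet inequality, and translation changes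
  only \<open>L v\<close>.\<close>

locale barycentric =
  fixes V :: "(real ^ 'n) set" and L :: "real ^ 'n \<Rightarrow> real ^ 'n \<Rightarrow> real" and l :: "real ^ 'n \<Rightarrow> real"
  assumes finite_V: "finite V" and linear_L: "\<And>v. v \<in> V \<Longrightarrow> linear (L v)"
    and L_V: "\<And>v w. v \<in> V \<Longrightarrow> w \<in> V \<Longrightarrow> L v w + l v = (if w = v then 1 else 0)"
    and affine_hull_V: "affine hull V = UNIV"
begin

lemma coordinates:
  assumes "sum u V = 1" "v \<in> V" shows "L v (\<Sum>w\<in>V. u w *\<^sub>R w) + l v = u v"
proof -
  have "L v (\<Sum>w\<in>V. u w *\<^sub>R w) + l v = (\<Sum>w\<in>V. u w * L v w) + (\<Sum>w\<in>V. u w) * l v"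
    using assms by (simp add: linear_sum[OF linear_L] linear_scale[OF linear_L])
  also have "\<dots> = (\<Sum>w\<in>V. u w * (L v w + l v))" by (simp add: sum_distrib_right distrib_left sum.distrib)
  also have "\<dots> = (\<Sum>w\<in>V. if w = v then u w else 0)" using assms by (intro sum.cong) (auto simp: L_V)
  also have "\<dots> = u v" using assms finite_V by simp
  finally show ?thesis .
qed

lemma reconstruct: "(\<Sum>v\<in>V. (L v x + l v) *\<^sub>R v) = x" "(\<Sum>v\<in>V. L v x + l v) = 1"
proof -
  have "x \<in> affine hull V" by (simp add: affine_hull_V)
  then obtain u where u: "sum u V = 1" "(\<Sum>v\<in>V. u v *\<^sub>R v) = x"
    using finite_V by (auto simp: affine_hull_finite)
  then have "\<And>v. v \<in> V \<Longrightarrow> L v x + l v = u v" using coordinates by blast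
  then show "(\<Sum>v\<in>V. (L v x + l v) *\<^sub>R v) = x" "(\<Sum>v\<in>V. L v x + l v) = 1" using u by simp_all
qed

lemma sum_l: "sum l V = 1"
  using reconstruct(2)[of 0] linear_0[OF linear_L] by simp

lemma sum_L: "(\<Sum>v\<in>V. L v x) = 0"
  using reconstruct(2)[of x] sum_l by (simp add: sum.distrib)

lemma in_dilation_iff:
  assumes "r \<ge> 0" shows "x \<in> (*\<^sub>R) r ` (convex hull V) \<longleftrightarrow> (\<forall>v\<in>V. L v x + r * l v \<ge> 0)"
proof
  assume "x \<in> (*\<^sub>R) r ` (convex hull V)"
  then obtain u where u: "\<forall>v\<in>V. u v \<ge> 0" "sum u V = 1" "x = r *\<^sub>R (\<Sum>v\<in>V. u v *\<^sub>R v)"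
    using finite_V by (auto simp: convex_hull_finite)
  show "\<forall>v\<in>V. L v x + r * l v \<ge> 0"
  proof
    fix v assume v: "v \<in> V"
    have "L v x + r * l v = r * (L v (\<Sum>v\<in>V. u v *\<^sub>R v) + l v)"
      using v by (simp add: u(3) linear_scale[OF linear_L] distrib_left)
    then show "L v x + r * l v \<ge> 0" using u v assms by (simp add: coordinates)
  qed
next
  assume pos: "\<forall>v\<in>V. L v x + r * l v \<ge> 0"
  show "x \<in> (*\<^sub>R) r ` (convex hull V)"
  proof (cases "r = 0")
    case True
    \<comment> \<open>Nonnegative numbers with sum zero vanish, so \<open>x\<close> has the
      barycentric coordinates of the origin.\<close>
    then have "\<forall>v\<in>V. L v x = 0" using pos sum_L[of x] finite_V by (simp add: sum_nonneg_eq_0_iff)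
    then have "x = (\<Sum>v\<in>V. l v *\<^sub>R v)" using reconstruct(1)[of x] by simp
    also have "\<dots> = 0" using reconstruct(1)[of 0] linear_0[OF linear_L] by simp
    finally have "x = 0" .
    have "convex hull V \<noteq> {}" using affine_hull_V by auto
    then obtain y where "y \<in> convex hull V" by blast
    then show ?thesis using True \<open>x = 0\<close> by (intro image_eqI[of _ _ y]) auto
  next
    case False
    then have r: "r > 0" using assms by simp
    define y where "y = (1 / r) *\<^sub>R x"
    have "L v y + l v \<ge> 0" if "v \<in> V" for v
    proof -
      have "L v y + l v = (L v x + r * l v) / r"
        using that r by (simp add: y_def linear_scale[OF linear_L] field_simps)
      then show ?thesis using pos that r by simp
    qed
    then have "y \<in> convex hull V"
      using finite_V reconstruct[of y] by (auto simp: convex_hull_finite intro!: exI[of _ "\<lambda>v. L v y + l v"])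
    then show ?thesis using r by (intro image_eqI[of _ _ y]) (auto simp: y_def)
  qed
qed

text \<open>Translations realise every change of the facet constants that preserves their sum. The
  sum alone therefore fixes the size of a homothet.\<close>

lemma ex_prescribed:
  assumes "sum s V = 0" shows "\<exists>z. \<forall>v\<in>V. L v z = s v"
proof (intro exI ballI)
  fix v assume v: "v \<in> V"
  have "L v (\<Sum>w\<in>V. s w *\<^sub>R w) = (\<Sum>w\<in>V. s w * L v w) + (\<Sum>w\<in>V. s w) * l v"
    using assms v by (simp add: linear_sum[OF linear_L] linear_scale[OF linear_L])
  also have "\<dots> = (\<Sum>w\<in>V. s w * (L v w + l v))" by (simp add: sum_distrib_right distrib_left sum.distrib)
  also have "\<dots> = (\<Sum>w\<in>V. if w = v then s w else 0)" using v by (intro sum.cong) (auto simp: L_V)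
  also have "\<dots> = s v" using v finite_V by simp
  finally show "L v (\<Sum>w\<in>V. s w *\<^sub>R w) = s v" .
qed

text \<open>Any intersection of homothets of a simplex is again a homothet, hence determined by one size parameter.\<close>

lemma homothet:
  assumes "sum q V \<ge> 0"
  shows "\<exists>z. {x. \<forall>v\<in>V. L v x + q v \<ge> 0} = (+) z ` (*\<^sub>R) (sum q V) ` (convex hull V)"
proof -
  have "(\<Sum>v\<in>V. sum q V * l v - q v) = 0" by (simp add: sum_subtractf sum_l flip: sum_distrib_left)
  from ex_prescribed[OF this] obtain z where z: "\<And>v. v \<in> V \<Longrightarrow> L v z = sum q V * l v - q v" by blast
  have "(\<forall>v\<in>V. L v x + q v \<ge> 0) \<longleftrightarrow> x \<in> (+) z ` (*\<^sub>R) (sum q V) ` (convex hull V)" for x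
  proof -
    have "x \<in> (+) z ` (*\<^sub>R) (sum q V) ` (convex hull V) \<longleftrightarrow> x - z \<in> (*\<^sub>R) (sum q V) ` (convex hull V)"
      by (metis (no_types, lifting) add_diff_cancel_left' diff_add_cancel add.commute image_iff)
    also have "\<dots> \<longleftrightarrow> (\<forall>v\<in>V. L v (x - z) + sum q V * l v \<ge> 0)" using assms by (rule in_dilation_iff)
    also have "\<dots> \<longleftrightarrow> (\<forall>v\<in>V. L v x + q v \<ge> 0)"
      by (intro ball_cong) (simp_all add: linear_diff[OF linear_L] z)
    finally show ?thesis by simp
  qed
  then show ?thesis by blast
qed

lemma homothet_empty: assumes "sum q V < 0" shows "{x. \<forall>v\<in>V. L v x + q v \<ge> 0} = {}"
proof (rule ccontr)
  assume "\<not> ?thesis"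
  then obtain x where "\<forall>v\<in>V. L v x + q v \<ge> 0" by auto
  then have "(\<Sum>v\<in>V. L v x + q v) \<ge> 0" by (intro sum_nonneg) auto
  then show False using assms by (simp add: sum.distrib sum_L)
qed

end

lemma simplex_barycentric:
  fixes S :: "(real ^ 'n) set"
  assumes "int CARD('n) simplex S"
  obtains V L l where "barycentric V L l" "S = convex hull V"
proof -
  obtain V where V: "\<not> affine_dependent V" "int (card V) = int CARD('n) + 1" "S = convex hull V"
    using assms by (auto simp: simplex_def)
  have card: "card V = CARD('n) + 1" using V(2) by linarith
  have fin: "finite V" using V(1) by (rule aff_independent_finite)
  have "\<exists>f c. linear f \<and> (\<forall>w\<in>V. f w + c = (if w = v then 1 else 0 :: real))" if v: "v \<in> V" for v
  proof -
    have "V \<noteq> {v}" using card by auto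
    then obtain v0 where v0: "v0 \<in> V" "v0 \<noteq> v" using v by auto
    have "independent ((\<lambda>x. - v0 + x) ` (V - {v0}))"
      using V(1) v0(1) affine_dependent_iff_dependent2[of v0 V] by blast
    \<comment> \<open>The functional dual to the edge \<open>v - v0\<close> among the edges at
      \<open>v0\<close>; the constant \<open>- f v0\<close> turns it into the coordinate at
      \<open>v\<close>.\<close>
    from linear_independent_extend[OF this, of "\<lambda>b. if b = v - v0 then 1 else 0 :: real"]
    obtain f where f: "linear f" "\<forall>x\<in>(\<lambda>x. - v0 + x) ` (V - {v0}). f x = (if x = v - v0 then 1 else 0 :: real)" by blast
    have "f w + (- f v0) = (if w = v then 1 else 0)" if "w \<in> V" for w
    proof (cases "w = v0")
      case False
      then have "f (- v0 + w) = (if - v0 + w = v - v0 then 1 else 0)" using f(2) that by blast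
      moreover have "f (- v0 + w) = f w - f v0" using linear_diff[OF f(1), of w v0] by simp
      ultimately show ?thesis by (simp add: algebra_simps)
    qed (use v0 in auto)
    then show ?thesis using f(1) by blast
  qed
  then have "\<forall>v\<in>V. \<exists>F. linear (fst F) \<and> (\<forall>w\<in>V. fst F w + snd F = (if w = v then 1 else 0 :: real))"
    by (metis fst_conv snd_conv)
  then obtain F where F: "\<forall>v\<in>V. linear (fst (F v)) \<and> (\<forall>w\<in>V. fst (F v) w + snd (F v) = (if w = v then 1 else 0 :: real))"
    unfolding bchoice_iff by blast
  have "aff_dim V = int CARD('n)" using aff_dim_unique[of V] aff_dim_affine_independent[OF V(1)] card by simp
  then have "affine hull V = UNIV"
    using aff_dim_eq_full[of V] by (simp add: aff_dim_affine_hull)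
  then have "barycentric V (\<lambda>v. fst (F v)) (\<lambda>v. snd (F v))"
    using F fin by (simp add: barycentric_def)
  then show ?thesis using that V(3) by blast
qed

lemma real_coeffs_eq_0:
  fixes c :: "nat \<Rightarrow> real"
  assumes "infinite A" "\<And>a. a \<in> A \<Longrightarrow> (\<Sum>m\<le>M. c m * a ^ m) = 0" "m \<le> M"
  shows "c m = 0"
proof -
  let ?q = "\<Sum>m\<le>M. monom (c m) m"
  have "A \<subseteq> {a. poly ?q a = 0}" using assms(2) by (auto simp: poly_sum poly_monom)
  then have "infinite {a. poly ?q a = 0}" using assms(1) finite_subset by blast
  then have "?q = 0" using poly_roots_finite by blast
  moreover have "coeff ?q m = c m" using assms(3) by (simp add: coeff_sum)
  ultimately show ?thesis by simp
qed

lemma emeasure_dilation: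
  fixes A :: "(real ^ 'n) set"
  assumes "compact A" "A \<noteq> {}" "r \<ge> 0"
  shows "emeasure lborel ((*\<^sub>R) r ` A) = ennreal (r ^ CARD('n)) * emeasure lborel A"
proof (cases "r = 0")
  case True
  then have "(*\<^sub>R) r ` A = {0}" using assms(2) by auto
  then show ?thesis using True by simp
next
  case False
  then have "{x. r *\<^sub>R x + 0 \<in> (*\<^sub>R) r ` A} = A" by auto
  then show ?thesis
    using False assms emeasure_lborel_affine[of r "(*\<^sub>R) r ` A" 0] compact_imp_closed[OF compact_scaling[OF assms(1), of r]]
    by simp
qed

lemma emeasure_translate:
  fixes A :: "'a::euclidean_space set"
  assumes "compact A"
  shows "emeasure lborel ((+) c ` A) = emeasure lborel A"
proof -
  have "{x. 1 *\<^sub>R x + c \<in> (+) c ` A} = A" by (auto simp: add.commute)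
  then show ?thesis
    using emeasure_lborel_affine[of 1 "(+) c ` A" c] compact_imp_closed[OF compact_translation[OF assms, of c]] by simp
qed

text \<open>After exchanging the integrals, the \<open>z\<close> that belong to a fixed
  \<open>x\<close> in \<open>X\<close> form a product of \<open>p\<close> translates of
  \<open>Y\<close>.\<close>

lemma nn_integral_emeasure_meet:
  fixes X Y :: "(real ^ 'n) set"
  assumes X: "compact X" and Y: "compact Y"
  shows "(\<integral>\<^sup>+ z. emeasure lborel {x \<in> X. \<forall>i<p. z i + x \<in> Y} \<partial>lborel_power p) = emeasure lborel X * emeasure lborel Y ^ p"
proof -
  let ?M = "lborel_power p :: (nat \<Rightarrow> real ^ 'n) measure"
  have XY: "X \<in> sets borel" "Y \<in> sets borel" using assms by (simp_all add: compact_imp_closed)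
  interpret q: sigma_finite_measure ?M
    by (rule lborel_product.sigma_finite) simp
  interpret pair: pair_sigma_finite ?M "lborel :: (real ^ 'n) measure" ..
  have m_snd: "snd \<in> borel_measurable (?M \<Otimes>\<^sub>M (lborel :: (real ^ 'n) measure))"
    using measurable_snd[of ?M lborel] by simp
  let ?T = "{w \<in> space (?M \<Otimes>\<^sub>M lborel). snd w \<in> X \<and> (\<forall>i\<in>{..<p}. fst w i + snd w \<in> Y)}"
  have "{w \<in> space (?M \<Otimes>\<^sub>M lborel). fst w i + snd w \<in> Y} \<in> sets (?M \<Otimes>\<^sub>M lborel)" if "i \<in> {..<p}" for i
  proof -
    have [measurable]: "(\<lambda>z. z i) \<in> measurable ?M lborel" using that by (rule measurable_component_singleton)
    have "(\<lambda>w. fst w i + snd w) \<in> borel_measurable (?M \<Otimes>\<^sub>M (lborel :: (real ^ 'n) measure))"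
      using measurable_compose[OF measurable_fst \<open>(\<lambda>z. z i) \<in> measurable ?M lborel\<close>, of lborel]
      by (intro borel_measurable_add) (simp_all add: m_snd)
    from measurable_sets[OF this XY(2)] show ?thesis by (simp add: vimage_def Int_def conj_commute)
  qed
  from sets.sets_Collect_finite_All[OF this finite_lessThan]
  have T1: "{w \<in> space (?M \<Otimes>\<^sub>M lborel). \<forall>i\<in>{..<p}. fst w i + snd w \<in> Y} \<in> sets (?M \<Otimes>\<^sub>M lborel)" .
  have T2: "{w \<in> space (?M \<Otimes>\<^sub>M lborel). snd w \<in> X} \<in> sets (?M \<Otimes>\<^sub>M lborel)"
    using measurable_sets[OF measurable_snd[of ?M lborel], of X] XY(1) by (simp add: vimage_def Int_def conj_commute)
  have T: "?T \<in> sets (?M \<Otimes>\<^sub>M lborel)" by (rule sets.sets_Collect_conj[OF T1 T2])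
  then have mT: "(\<lambda>(z, x). indicator ?T (z, x) :: ennreal) \<in> borel_measurable (?M \<Otimes>\<^sub>M lborel)"
    by (simp add: case_prod_unfold)
  have inner: "(\<integral>\<^sup>+ x. indicator ?T (z, x) \<partial>lborel) = emeasure lborel {x \<in> X. \<forall>i<p. z i + x \<in> Y}" if "z \<in> space ?M" for z
  proof -
    have sets: "Pair z -` ?T \<in> sets lborel" by (rule sets_Pair1[OF T])
    have eq: "Pair z -` ?T = {x \<in> X. \<forall>i<p. z i + x \<in> Y}"
      using that by (auto simp: space_pair_measure)
    have "(\<integral>\<^sup>+ x. indicator ?T (z, x) \<partial>lborel) = (\<integral>\<^sup>+ x. indicator (Pair z -` ?T) x \<partial>lborel)"
      by (simp only: indicator_vimage o_def)
    also have "\<dots> = emeasure lborel (Pair z -` ?T)" by (rule nn_integral_indicator[OF sets])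
    finally show ?thesis unfolding eq .
  qed
  have "(\<integral>\<^sup>+ z. emeasure lborel {x \<in> X. \<forall>i<p. z i + x \<in> Y} \<partial>?M) = (\<integral>\<^sup>+ z. (\<integral>\<^sup>+ x. indicator ?T (z, x) \<partial>lborel) \<partial>?M)"
    by (intro nn_integral_cong) (simp only: inner)
  also have "\<dots> = (\<integral>\<^sup>+ x. (\<integral>\<^sup>+ z. indicator ?T (z, x) \<partial>?M) \<partial>lborel)"
    using pair.Fubini'[OF mT] by simp
  also have "\<dots> = (\<integral>\<^sup>+ x. emeasure lborel Y ^ p * indicator X x \<partial>lborel)"
  proof (intro nn_integral_cong)
    fix x :: "real ^ 'n"
    have shifted: "(+) (- x) ` Y \<in> sets lborel"
      unfolding sets_lborel by (rule borel_compact[OF compact_translation[OF Y]])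
    have "indicator ?T (z, x) = indicator X x * (indicator (\<Pi>\<^sub>E i\<in>{..<p}. (+) (- x) ` Y) z :: ennreal)" if "z \<in> space ?M" for z
    proof -
      have "z i + x \<in> Y \<longleftrightarrow> z i \<in> (+) (- x) ` Y" for i by (auto simp: image_iff algebra_simps)
      then show ?thesis using that by (auto simp: indicator_def space_pair_measure space_PiM PiE_iff)
    qed
    then have "(\<integral>\<^sup>+ z. indicator ?T (z, x) \<partial>?M) = (\<integral>\<^sup>+ z. indicator X x * indicator (\<Pi>\<^sub>E i\<in>{..<p}. (+) (- x) ` Y) z \<partial>?M)"
      by (intro nn_integral_cong)
    also have "\<dots> = indicator X x * emeasure ?M (\<Pi>\<^sub>E i\<in>{..<p}. (+) (- x) ` Y)"
      using shifted by (intro nn_integral_cmult_indicator sets_PiM_I_finite) auto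
    also have "emeasure ?M (\<Pi>\<^sub>E i\<in>{..<p}. (+) (- x) ` Y) = emeasure lborel Y ^ p"
      using shifted emeasure_translate[OF Y, of "- x"] by (subst lborel_product.emeasure_PiM) auto
    finally show "(\<integral>\<^sup>+ z. indicator ?T (z, x) \<partial>?M) = emeasure lborel Y ^ p * indicator X x" by (simp add: mult.commute)
  qed
  also have "\<dots> = emeasure lborel X * emeasure lborel Y ^ p"
    using XY by (subst nn_integral_cmult_indicator) (auto simp: mult.commute)
  finally show ?thesis .
qed

section \<open>The integral equation for a simplex\<close>

context barycentric
begin

abbreviation "S \<equiv> convex hull V"

text \<open>\<open>a S\<close> and the sets \<open>b S - z i\<close> each impose one inequality on
  \<open>L v x\<close> for the facet of \<open>v\<close>; the smallest constant is the binding one.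
  The sum over \<open>v\<close> is the size of the intersection, negative if the intersection is
  empty.\<close>

definition slack :: "nat \<Rightarrow> real \<Rightarrow> real \<Rightarrow> (nat \<Rightarrow> real ^ 'n) \<Rightarrow> real ^ 'n \<Rightarrow> real" where
  "slack p a b z v = Min (insert (a * l v) ((\<lambda>i. b * l v + L v (z i)) ` {..<p}))"

definition meet_size :: "nat \<Rightarrow> real \<Rightarrow> real \<Rightarrow> (nat \<Rightarrow> real ^ 'n) \<Rightarrow> real" where
  "meet_size p a b z = (\<Sum>v\<in>V. slack p a b z v)"

lemma compact_S: "compact S" and convex_S: "convex S" and V_nonempty: "V \<noteq> {}"
  using finite_V affine_hull_V by (auto simp: finite_imp_compact_convex_hull)

text \<open>Shrinking by \<open>r\<close> subtracts the same \<open>r * l v\<close> from all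
  constants that belong to \<open>v\<close>, so it passes through the minimum.\<close>

lemma meet_iff:
  assumes "r \<le> a" "r \<le> b"
  shows "x \<in> (*\<^sub>R) (a - r) ` S \<and> (\<forall>i<p. z i + x \<in> (*\<^sub>R) (b - r) ` S) \<longleftrightarrow>
    (\<forall>v\<in>V. L v x + (slack p a b z v - r * l v) \<ge> 0)"
proof -
  have "L v x + (slack p a b z v - r * l v) \<ge> 0 \<longleftrightarrow>
     L v x + (a - r) * l v \<ge> 0 \<and> (\<forall>i<p. L v (z i + x) + (b - r) * l v \<ge> 0)" if v: "v \<in> V" for v
  proof -
    have "L v x + (slack p a b z v - r * l v) \<ge> 0 \<longleftrightarrow> r * l v - L v x \<le> slack p a b z v" by linarith
    also have "\<dots> \<longleftrightarrow> r * l v - L v x \<le> a * l v \<and> (\<forall>i<p. r * l v - L v x \<le> b * l v + L v (z i))"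
      unfolding slack_def by (subst Min_ge_iff) auto
    also have "\<dots> \<longleftrightarrow> L v x + (a - r) * l v \<ge> 0 \<and> (\<forall>i<p. L v (z i + x) + (b - r) * l v \<ge> 0)"
      by (simp add: linear_add[OF linear_L[OF v]] algebra_simps)
    finally show ?thesis .
  qed
  then show ?thesis using assms by (auto simp: in_dilation_iff)
qed

lemma sum_slack: "(\<Sum>v\<in>V. slack p a b z v - r * l v) = meet_size p a b z - r"
  by (simp add: meet_size_def sum_subtractf sum_l flip: sum_distrib_left)

text \<open>Shrinking both simplices by \<open>r\<close> lowers the size of the intersection by exactly \<open>r\<close>.\<close>

lemma hitting_set_iff_meet_size:
  assumes "r \<le> a" "r \<le> b" "z \<in> space (lborel_power p)"
  shows "z \<in> hitting_set p ((*\<^sub>R) (a - r) ` S) ((*\<^sub>R) (b - r) ` S) \<longleftrightarrow> r \<le> meet_size p a b z"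
proof -
  let ?Q = "{x. \<forall>v\<in>V. L v x + (slack p a b z v - r * l v) \<ge> 0}"
  have "z \<in> hitting_set p ((*\<^sub>R) (a - r) ` S) ((*\<^sub>R) (b - r) ` S) \<longleftrightarrow>
     (\<exists>x. x \<in> (*\<^sub>R) (a - r) ` S \<and> (\<forall>i<p. z i + x \<in> (*\<^sub>R) (b - r) ` S))"
    using assms(3) unfolding hitting_set_def by blast
  also have "\<dots> \<longleftrightarrow> ?Q \<noteq> {}" using meet_iff[OF assms(1,2)] by auto
  also have "\<dots> \<longleftrightarrow> r \<le> meet_size p a b z"
  proof (cases "r \<le> meet_size p a b z")
    case True
    then obtain w where "?Q = (+) w ` (*\<^sub>R) (meet_size p a b z - r) ` S"
      using homothet[of "\<lambda>v. slack p a b z v - r * l v"] by (auto simp: sum_slack)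
    then have "?Q \<noteq> {}" using V_nonempty by (simp only: image_is_empty convex_hull_eq_empty not_False_eq_True)
    then show ?thesis using True by blast
  next
    case False
    then show ?thesis
      using homothet_empty[of "\<lambda>v. slack p a b z v - r * l v"] by (simp add: sum_slack)
  qed
  finally show ?thesis .
qed

lemma meet_size_le: "meet_size p a b z \<le> a"
proof -
  have "meet_size p a b z \<le> (\<Sum>v\<in>V. a * l v)"
    unfolding meet_size_def slack_def by (intro sum_mono Min_le) auto
  then show ?thesis by (simp add: sum_l flip: sum_distrib_left)
qed

lemma emeasure_meet:
  assumes "a \<ge> 0" "b \<ge> 0"
  shows "emeasure lborel {x \<in> (*\<^sub>R) a ` S. \<forall>i<p. z i + x \<in> (*\<^sub>R) b ` S} =
    ennreal (max 0 (meet_size p a b z) ^ CARD('n)) * emeasure lborel S"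
proof -
  have eq: "{x \<in> (*\<^sub>R) a ` S. \<forall>i<p. z i + x \<in> (*\<^sub>R) b ` S} = {x. \<forall>v\<in>V. L v x + slack p a b z v \<ge> 0}"
    using meet_iff[of 0 a b _ p z] assms by auto
  show ?thesis
  proof (cases "meet_size p a b z \<ge> 0")
    case True
    then obtain w where "{x. \<forall>v\<in>V. L v x + slack p a b z v \<ge> 0} = (+) w ` (*\<^sub>R) (meet_size p a b z) ` S"
      using homothet[of "slack p a b z"] by (auto simp: meet_size_def)
    then show ?thesis
      using True emeasure_dilation[OF compact_S _ True] V_nonempty
      by (simp add: eq emeasure_translate compact_scaling compact_S)
  next
    case False
    then have "{x. \<forall>v\<in>V. L v x + slack p a b z v \<ge> 0} = {}"
      by (intro homothet_empty) (simp add: meet_size_def)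
    then show ?thesis unfolding eq using False by (simp del: empty_Collect_eq Collect_empty_eq)
  qed
qed

text \<open>For \<open>r \<le> a\<close> the set where the size is at least \<open>r\<close> is a
  hitting set of shrunken simplices; for larger \<open>r\<close> it is empty.\<close>

lemma measurable_meet_size:
  assumes "a \<le> b"
  shows "meet_size p a b \<in> borel_measurable (lborel_power p)"
  unfolding borel_measurable_iff_ge
proof
  fix r
  show "{z \<in> space (lborel_power p). r \<le> meet_size p a b z} \<in> sets (lborel_power p)"
  proof (cases "r \<le> a")
    case True
    then have "{z \<in> space (lborel_power p). r \<le> meet_size p a b z} = hitting_set p ((*\<^sub>R) (a - r) ` S) ((*\<^sub>R) (b - r) ` S)"
      using hitting_set_iff_meet_size[of r a b _ p] assms by (auto simp: hitting_set_def)
    then show ?thesis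
      using hitting_set_measurable[OF compact_scaling[OF compact_S] _ compact_scaling[OF compact_S]] V_nonempty by simp
  next
    case False
    then have "\<not> r \<le> meet_size p a b z" for z using meet_size_le[of p a b z] by linarith
    then show ?thesis by simp
  qed
qed

text \<open>Integration by layers: the n-th power of a size \<open>s\<close> in
  \<open>{0..a}\<close> is the integral of \<open>n * r ^ (n - 1)\<close> over
  \<open>{0..s}\<close>, and the layer at \<open>r\<close> is the hitting set of the simplices
  shrunk by \<open>r\<close>.\<close>

lemma nn_integral_meet_size:
  assumes "0 \<le> a" "a \<le> b"
  shows "(\<integral>\<^sup>+ z. ennreal (max 0 (meet_size p a b z) ^ CARD('n)) \<partial>lborel_power p) =
    (\<integral>\<^sup>+ r. ennreal (real CARD('n) * r ^ (CARD('n) - 1) * pvol p (hitting_set p ((*\<^sub>R) (a - r) ` S) ((*\<^sub>R) (b - r) ` S)))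
       * indicator {0..a} r \<partial>lborel)"
proof -
  let ?M = "lborel_power p :: (nat \<Rightarrow> real ^ 'n) measure"
  let ?n = "CARD('n)"
  let ?k = "\<lambda>r. real ?n * r ^ (?n - 1)"
  have [measurable]: "meet_size p a b \<in> borel_measurable ?M" by (rule measurable_meet_size[OF assms(2)])
  interpret q: sigma_finite_measure ?M
    by (rule lborel_product.sigma_finite) simp
  interpret pair: pair_sigma_finite ?M "lborel :: real measure" ..
  have pow: "ennreal (max 0 s ^ ?n) = (\<integral>\<^sup>+ r. ennreal (?k r) * (indicator {0..a} r * indicator {r. r \<le> s} r) \<partial>lborel)"
    if "s \<le> a" for s
  proof (cases "s \<ge> 0")
    case True
    have "((\<lambda>r. ?k r * (s - r) ^ 0) has_integral s ^ (?n + 0) / real ((?n + 0) choose ?n)) {0..s}"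
      by (rule simplex_kernel_integral[OF True]) simp
    then have "((\<lambda>r. ?k r) has_integral s ^ ?n) {0..s}" by simp
    then have "(\<integral>\<^sup>+ r. ennreal (?k r) * indicator {0..s} r \<partial>lborel) = ennreal (s ^ ?n)"
      by (intro nn_integral_has_integral_lebesgue') auto
    moreover have "indicator {0..a} r * indicator {r. r \<le> s} r = (indicator {0..s} r :: ennreal)" for r
      using that by (auto simp: indicator_def)
    ultimately show ?thesis using True by simp
  next
    case False
    then have "(\<integral>\<^sup>+ r. ennreal (?k r) * (indicator {0..a} r * indicator {r. r \<le> s} r) \<partial>lborel) = (\<integral>\<^sup>+ r. 0 \<partial>(lborel :: real measure))"
      by (intro nn_integral_cong) (auto simp: indicator_def)
    then show ?thesis using False by simp
  qed
  have "(\<integral>\<^sup>+ z. ennreal (max 0 (meet_size p a b z) ^ ?n) \<partial>?M) =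
     (\<integral>\<^sup>+ z. (\<integral>\<^sup>+ r. ennreal (?k r) * (indicator {0..a} r * indicator {r. r \<le> meet_size p a b z} r) \<partial>lborel) \<partial>?M)"
    by (intro nn_integral_cong pow meet_size_le)
  also have "\<dots> = (\<integral>\<^sup>+ r. (\<integral>\<^sup>+ z. ennreal (?k r) * (indicator {0..a} r * indicator {r. r \<le> meet_size p a b z} r) \<partial>?M) \<partial>lborel)"
    by (rule pair.Fubini'[symmetric]) measurable
  also have "\<dots> = (\<integral>\<^sup>+ r. ennreal (?k r * pvol p (hitting_set p ((*\<^sub>R) (a - r) ` S) ((*\<^sub>R) (b - r) ` S))) * indicator {0..a} r \<partial>lborel)"
  proof (intro nn_integral_cong)
    fix r :: real
    let ?H = "hitting_set p ((*\<^sub>R) (a - r) ` S) ((*\<^sub>R) (b - r) ` S)"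
    show "(\<integral>\<^sup>+ z. ennreal (?k r) * (indicator {0..a} r * indicator {r. r \<le> meet_size p a b z} r) \<partial>?M) =
      ennreal (?k r * pvol p ?H) * indicator {0..a} r"
    proof (cases "r \<in> {0..a}")
      case True
      have H: "?H \<in> sets ?M"
        using hitting_set_measurable[OF compact_scaling[OF compact_S] _ compact_scaling[OF compact_S]] V_nonempty by simp
      have "(\<integral>\<^sup>+ z. ennreal (?k r) * (indicator {0..a} r * indicator {r. r \<le> meet_size p a b z} r) \<partial>?M) =
         (\<integral>\<^sup>+ z. ennreal (?k r) * indicator ?H z \<partial>?M)"
        using True assms hitting_set_iff_meet_size[of r a b _ p]
        by (intro nn_integral_cong) (auto simp: indicator_def)
      also have "\<dots> = ennreal (?k r) * emeasure ?M ?H" using H by (rule nn_integral_cmult_indicator)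
      also have "emeasure ?M ?H = ennreal (pvol p ?H)"
        using emeasure_hitting_set_finite[OF compact_scaling[OF compact_S] compact_scaling[OF compact_S], of p "a - r" "b - r"]
        unfolding pvol_def by (intro emeasure_eq_ennreal_measure) auto
      finally show ?thesis using True by (simp add: ennreal_mult' pvol_def)
    qed simp
  qed
  finally show ?thesis .
qed

end

subsection \<open>Comparison of coefficients\<close>

lemma measure_pos_full_dim:
  fixes K :: "'a::euclidean_space set"
  assumes "compact K" "convex K" "affine hull K = UNIV"
  shows "measure lborel K > 0"
proof (rule ccontr)
  assume "\<not> ?thesis"
  then have "measure lborel K = 0" using measure_nonneg[of lborel K] by linarith
  then have "emeasure lborel K = 0"
    using emeasure_eq_ennreal_measure[of lborel K] emeasure_compact_finite[OF assms(1)] by simp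
  then have "K \<in> null_sets lborel" using assms(1) by (intro null_setsI) (auto simp: borel_compact)
  then have "negligible K" by (simp add: negligible_iff_null_sets null_sets_completionI)
  then have "interior K = {}"
    by (metis interior_subset negligible_subset open_interior open_not_negligible)
  moreover have "K \<noteq> {}" using assms(3) by auto
  ultimately show False
    using assms(2,3) by (metis rel_interior_eq_empty rel_interior_interior)
qed

text \<open>The integrated volume of intersections, computed by layers and by Fubini, yields an
  identity in \<open>a\<close> that determines every coefficient \<open>H m\<close> of the volume at
  \<open>b = a + 1\<close>. By \<open>binomial_convolution\<close> the claimed values of
  \<open>c\<close> produce the same polynomial, and that polynomial determines
  \<open>c\<close>.\<close>

lemma (in barycentric) dilation_polynomial_coeffs:
  assumes p: "p \<ge> 1" and j: "j \<le> CARD('n)"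
   and c: "\<And>a b. a \<ge> 0 \<Longrightarrow> b \<ge> 0 \<Longrightarrow> pvol p (hitting_set p ((*\<^sub>R) a ` S) ((*\<^sub>R) b ` S)) =
    (\<Sum>j\<le>CARD('n). real ((CARD('n) * p) choose j) * c j * a ^ j * b ^ (CARD('n) * p - j))"
  shows "c j = real (CARD('n) choose j) * measure lborel S ^ p"
proof -
  let ?n = "CARD('n)" and ?N = "CARD('n) * p" and ?s = "measure lborel S"
  have nN: "?n \<le> ?N" using p by simp
  have s: "?s > 0"
    by (rule measure_pos_full_dim[OF compact_S convex_S]) (simp add: affine_hull_V)
  have E: "emeasure lborel S = ennreal ?s"
    using emeasure_compact_finite[OF compact_S] by (intro emeasure_eq_ennreal_measure) auto
  \<comment> \<open>Shrinking both simplices by \<open>r\<close> preserves \<open>b - a\<close>.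
    Fixing this difference at 1 makes the integrand a single polynomial evaluated at
    \<open>a - r\<close>.\<close>
  let ?P = "\<lambda>a. \<Sum>j\<le>?n. real (?N choose j) * c j * a ^ j * (a + 1) ^ (?N - j)"
  obtain H where H: "\<And>a. ?P a = (\<Sum>m\<le>?N. H m * a ^ m)"
  proof -
    let ?q = "\<Sum>j\<le>?n. smult (real (?N choose j) * c j) (monom 1 j * [:1, 1:] ^ (?N - j))"
    have "degree (smult (real (?N choose j) * c j) (monom 1 j * [:1, 1:] ^ (?N - j))) \<le> ?N" if "j \<le> ?n" for j
    proof -
      have "degree ([:1, 1:] ^ (?N - j) :: real poly) \<le> ?N - j" using degree_power_le[of "[:1, 1::real:]" "?N - j"] by simp
      moreover have "degree (monom (1::real) j) \<le> j" by (rule degree_monom_le)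
      ultimately have "degree (monom 1 j * [:1, 1:] ^ (?N - j) :: real poly) \<le> ?N"
        using degree_mult_le[of "monom (1::real) j" "[:1, 1:] ^ (?N - j)"] that nN by linarith
      then show ?thesis using degree_smult_le order_trans by blast
    qed
    then have deg: "degree ?q \<le> ?N" by (intro degree_sum_le) auto
    have "?P a = poly ?q a" for a by (simp add: poly_sum poly_monom add.commute mult.assoc)
    also have "poly ?q a = (\<Sum>m\<le>?N. coeff ?q m * a ^ m)" for a
      unfolding poly_altdef by (rule sum.mono_neutral_left) (use deg in \<open>auto intro: coeff_eq_0\<close>)
    finally show ?thesis using that by blast
  qed
  have key: "(\<Sum>m\<le>?N. H m * a ^ (?n + m) / real ((?n + m) choose ?n)) = a ^ ?n * (a + 1) ^ ?N * ?s ^ p" (is "?I = _")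
    if a: "a \<ge> 0" for a
  proof -
    let ?f = "\<lambda>r. real ?n * r ^ (?n - 1) * pvol p (hitting_set p ((*\<^sub>R) (a - r) ` S) ((*\<^sub>R) (a + 1 - r) ` S))"
    have "((\<lambda>r. \<Sum>m\<le>?N. H m * (real ?n * r ^ (?n - 1) * (a - r) ^ m)) has_integral
        (\<Sum>m\<le>?N. H m * (a ^ (?n + m) / real ((?n + m) choose ?n)))) {0..a}"
      by (intro has_integral_sum has_integral_mult_right simplex_kernel_integral a) auto
    moreover have "(\<Sum>m\<le>?N. H m * (real ?n * r ^ (?n - 1) * (a - r) ^ m)) = ?f r" if "r \<in> {0..a}" for r
    proof -
      have b: "a + 1 - r = a - r + 1" by simp
      have "pvol p (hitting_set p ((*\<^sub>R) (a - r) ` S) ((*\<^sub>R) (a + 1 - r) ` S)) = ?P (a - r)"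
        unfolding b by (rule c) (use that in auto)
      then show ?thesis unfolding H by (simp only: sum_distrib_left mult_ac)
    qed
    ultimately have "(?f has_integral (\<Sum>m\<le>?N. H m * (a ^ (?n + m) / real ((?n + m) choose ?n)))) {0..a}"
      by (rule has_integral_eq[rotated])
    then have int: "(?f has_integral ?I) {0..a}" by (simp only: times_divide_eq_right)
    have nonneg: "0 \<le> ?f r" if "r \<in> {0..a}" for r using that by (simp add: pvol_def)
    have I0: "?I \<ge> 0" using has_integral_nonneg[OF int nonneg] .
    have "(\<integral>\<^sup>+ z. ennreal (max 0 (meet_size p a (a + 1) z) ^ ?n) \<partial>lborel_power p) = ennreal ?I"
      using nn_integral_meet_size[OF a, of "a + 1" p] nn_integral_has_integral_lebesgue'[OF nonneg int] by simp
    \<comment> \<open>Multiplied by the volume of \<open>S\<close>, the n-th power of the size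
      becomes the volume of the intersection, to which Fubini applies.\<close>
    then have "ennreal ?I * ennreal ?s = (\<integral>\<^sup>+ z. ennreal (max 0 (meet_size p a (a + 1) z) ^ ?n) * emeasure lborel S \<partial>lborel_power p)"
      using measurable_meet_size[of a "a + 1" p] by (subst nn_integral_multc) (auto simp: E)
    also have "\<dots> = (\<integral>\<^sup>+ z. emeasure lborel {x \<in> (*\<^sub>R) a ` S. \<forall>i<p. z i + x \<in> (*\<^sub>R) (a + 1) ` S} \<partial>lborel_power p)"
      using a by (subst emeasure_meet) auto
    also have "\<dots> = emeasure lborel ((*\<^sub>R) a ` S) * emeasure lborel ((*\<^sub>R) (a + 1) ` S) ^ p"
      by (intro nn_integral_emeasure_meet compact_scaling compact_S)
    also have "\<dots> = ennreal (a ^ ?n * ?s * ((a + 1) ^ ?n * ?s) ^ p)"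
      using a V_nonempty s emeasure_dilation[OF compact_S _ a] emeasure_dilation[OF compact_S, of "a + 1"]
      by (simp add: E ennreal_power flip: ennreal_mult)
    finally have "?I * ?s = a ^ ?n * ?s * ((a + 1) ^ ?n * ?s) ^ p"
      using I0 s a by (simp flip: ennreal_mult)
    also have "\<dots> = a ^ ?n * (a + 1) ^ ?N * ?s ^ p * ?s"
      by (simp add: power_mult_distrib power_mult)
    finally show ?thesis using s by simp
  qed
  have Hm: "H m = ?s ^ p * real (?N choose m) * real ((?n + m) choose ?n)" if "m \<le> ?N" for m
  proof -
    have "H m / real ((?n + m) choose ?n) - ?s ^ p * real (?N choose m) = 0"
    proof (rule real_coeffs_eq_0[OF _ _ that])
      show "infinite {0::real<..}" by (rule infinite_Ioi)
      fix a :: real assume "a \<in> {0<..}"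
      then have a: "a > 0" by simp
      have "a ^ ?n * (\<Sum>m\<le>?N. H m / real ((?n + m) choose ?n) * a ^ m) =
          (\<Sum>m\<le>?N. H m * a ^ (?n + m) / real ((?n + m) choose ?n))"
        by (simp add: sum_distrib_left power_add mult_ac)
      also have "\<dots> = a ^ ?n * (a + 1) ^ ?N * ?s ^ p" using key a by simp
      also have "\<dots> = a ^ ?n * (\<Sum>m\<le>?N. ?s ^ p * real (?N choose m) * a ^ m)"
        by (simp add: binomial_ring sum_distrib_left mult_ac)
      finally have "(\<Sum>m\<le>?N. H m / real ((?n + m) choose ?n) * a ^ m) = (\<Sum>m\<le>?N. ?s ^ p * real (?N choose m) * a ^ m)"
        using a by simp
      then show "(\<Sum>m\<le>?N. (H m / real ((?n + m) choose ?n) - ?s ^ p * real (?N choose m)) * a ^ m) = 0"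
        by (simp add: left_diff_distrib sum_subtractf)
    qed
    moreover have "real ((?n + m) choose ?n) \<noteq> 0" by simp
    ultimately show ?thesis by (simp add: field_simps)
  qed
  have "real (?N choose j) * (c j - ?s ^ p * real (?n choose j)) = 0"
  proof (rule real_coeffs_eq_0[OF _ _ j])
    show "infinite {0::real<..<1}" by simp
    fix t :: real assume t: "t \<in> {0<..<1}"
    \<comment> \<open>With this substitution \<open>a ^ j * (a + 1) ^ (?N - j)\<close> becomes
      \<open>t ^ j\<close> up to a factor independent of \<open>j\<close>, so ordinary coefficients
      can be compared.\<close>
    define a where "a = t / (1 - t)"
    have a1: "a + 1 = 1 / (1 - t)" using t by (simp add: a_def field_simps)
    have pw: "(1 - t) ^ ?N * (a ^ j * (a + 1) ^ (?N - j)) = t ^ j" if "j \<le> ?n" for j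
    proof -
      have "j \<le> ?N" using that nN by (rule order_trans)
      then have "(1 - t) ^ ?N = (1 - t) ^ j * (1 - t) ^ (?N - j)" by (metis le_add_diff_inverse power_add)
      then show ?thesis using t unfolding a1 by (simp add: a_def power_divide)
    qed
    have "?P a = ?s ^ p * (\<Sum>m\<le>?N. real (?N choose m) * real ((?n + m) choose ?n) * a ^ m)"
      unfolding H sum_distrib_left by (intro sum.cong) (simp_all add: Hm)
    also have "\<dots> = ?s ^ p * (\<Sum>j\<le>?n. real (?N choose j) * real (?n choose j) * a ^ j * (a + 1) ^ (?N - j))"
      by (simp only: binomial_convolution)
    finally have "(1 - t) ^ ?N * ?P a = (1 - t) ^ ?N * (?s ^ p * (\<Sum>j\<le>?n. real (?N choose j) * real (?n choose j) * a ^ j * (a + 1) ^ (?N - j)))"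
      by simp
    moreover have "(1 - t) ^ ?N * ?P a = (\<Sum>j\<le>?n. real (?N choose j) * c j * ((1 - t) ^ ?N * (a ^ j * (a + 1) ^ (?N - j))))"
      by (simp add: sum_distrib_left mult_ac)
    moreover have "(1 - t) ^ ?N * (?s ^ p * (\<Sum>j\<le>?n. real (?N choose j) * real (?n choose j) * a ^ j * (a + 1) ^ (?N - j))) =
       (\<Sum>j\<le>?n. real (?N choose j) * (?s ^ p * real (?n choose j)) * ((1 - t) ^ ?N * (a ^ j * (a + 1) ^ (?N - j))))"
      by (simp add: sum_distrib_left mult_ac)
    ultimately have "(\<Sum>j\<le>?n. real (?N choose j) * c j * t ^ j) = (\<Sum>j\<le>?n. real (?N choose j) * (?s ^ p * real (?n choose j)) * t ^ j)"
      by (simp add: pw)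
    then show "(\<Sum>j\<le>?n. real (?N choose j) * (c j - ?s ^ p * real (?n choose j)) * t ^ j) = 0"
      by (simp add: right_diff_distrib left_diff_distrib sum_subtractf)
  qed
  moreover have "?N choose j \<noteq> 0" using order_trans[OF j nN] by (simp only: binomial_eq_0_iff not_less)
  ultimately show ?thesis by simp
qed

text \<open>Integrating against the positive weights of the Beta integral removes the binomial coefficients.\<close>

lemma binomial_weights_removal:
  fixes e :: "nat \<Rightarrow> real"
  assumes nonneg: "\<And>u. u \<in> {0..1} \<Longrightarrow> (\<Sum>j\<le>n. real (N choose j) * e j * u ^ j * (1 - u) ^ (N - j)) \<ge> 0"
    and "n \<le> N" and t: "t \<in> {0<..<1}"
  shows "(\<Sum>j\<le>n. e j * t ^ j * (1 - t) ^ (n - j)) \<ge> 0" (is "?ge")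
    and "(\<Sum>j\<le>n. e j * t ^ j * (1 - t) ^ (n - j)) = 0 \<Longrightarrow> j \<le> n \<Longrightarrow> e j = 0" (is "?eq \<Longrightarrow> _ \<Longrightarrow> _")
proof -
  define s where "s j = e j * t ^ j * (1 - t) ^ (n - j)" for j
  define R where "R u = (\<Sum>j\<le>n. real (N choose j) * s j * (u ^ j * (1 - u) ^ (N - j)))" for u
  have R0: "R u \<ge> 0" if u: "u \<in> {0..1}" for u
  proof -
    let ?A = "t * u" and ?B = "(1 - t) * (1 - u)"
    have AB: "?A \<ge> 0" "?B \<ge> 0" using t u by auto
    have pos: "?A + ?B > 0"
    proof (cases "u = 0")
      case False
      then have "?A > 0" using t u by simp
      then show ?thesis using AB by linarith
    qed (use t in simp)
    \<comment> \<open>In terms of odds, \<open>w / (1 - w)\<close> is \<open>u / (1 - u)\<close>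
      multiplied by \<open>t / (1 - t)\<close>.\<close>
    define w where "w = ?A / (?A + ?B)"
    have w: "w \<in> {0..1}" using AB pos by (auto simp: w_def divide_simps)
    have w1: "1 - w = ?B / (?A + ?B)" using pos by (simp add: w_def field_simps)
    \<comment> \<open>The terms \<open>s j\<close> carry the exponent \<open>n - j\<close>, those of
      the hypothesis \<open>N - j\<close>; the factor \<open>(1 - t) ^ (N - n)\<close> makes up the
      difference.\<close>
    have "(1 - t) ^ (N - n) * R u = (?A + ?B) ^ N * (\<Sum>j\<le>n. real (N choose j) * e j * w ^ j * (1 - w) ^ (N - j))"
      unfolding R_def sum_distrib_left
    proof (intro sum.cong refl)
      fix j assume j: "j \<in> {..n}"
      have p1: "(1 - t) ^ (N - j) = (1 - t) ^ (N - n) * (1 - t) ^ (n - j)" using j \<open>n \<le> N\<close> by (simp flip: power_add)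
      have p2: "(?A + ?B) ^ N = (?A + ?B) ^ j * (?A + ?B) ^ (N - j)" using j \<open>n \<le> N\<close> by (simp flip: power_add)
      have "(?A + ?B) ^ N * (w ^ j * (1 - w) ^ (N - j)) = ?A ^ j * ?B ^ (N - j)"
        using pos unfolding p2 w1 by (simp add: w_def power_divide)
      also have "\<dots> = (1 - t) ^ (N - n) * (t ^ j * (1 - t) ^ (n - j)) * (u ^ j * (1 - u) ^ (N - j))"
        unfolding power_mult_distrib p1 by (simp add: mult_ac)
      finally have "real (N choose j) * e j * ((?A + ?B) ^ N * (w ^ j * (1 - w) ^ (N - j))) =
          real (N choose j) * e j * ((1 - t) ^ (N - n) * (t ^ j * (1 - t) ^ (n - j)) * (u ^ j * (1 - u) ^ (N - j)))"
        by simp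
      then show "(1 - t) ^ (N - n) * (real (N choose j) * s j * (u ^ j * (1 - u) ^ (N - j))) =
          (?A + ?B) ^ N * (real (N choose j) * e j * w ^ j * (1 - w) ^ (N - j))"
        by (simp only: s_def mult_ac)
    qed
    also have "\<dots> \<ge> 0" using nonneg[OF w] pos by simp
    finally have "0 \<le> (1 - t) ^ (N - n) * R u" .
    moreover have "(1 - t) ^ (N - n) > 0" using t by simp
    ultimately show ?thesis by (simp only: zero_le_mult_iff) linarith
  qed
  have "(R has_integral (\<Sum>j\<le>n. real (N choose j) * s j * (fact j * fact (N - j) / fact (j + (N - j) + 1) * 1 ^ (j + (N - j) + 1)))) {0..1}"
    unfolding R_def by (intro has_integral_sum has_integral_mult_right beta_integral_nat) auto
  also have "(\<Sum>j\<le>n. real (N choose j) * s j * (fact j * fact (N - j) / fact (j + (N - j) + 1) * 1 ^ (j + (N - j) + 1))) =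
      sum s {..n} / (real N + 1)"
    unfolding sum_divide_distrib
  proof (intro sum.cong refl)
    fix j assume "j \<in> {..n}"
    then have j: "j \<le> N" using \<open>n \<le> N\<close> by simp
    then have "real (N choose j) = fact N / (fact j * fact (N - j))" by (rule binomial_fact)
    then show "real (N choose j) * s j * (fact j * fact (N - j) / fact (j + (N - j) + 1) * 1 ^ (j + (N - j) + 1)) = s j / (real N + 1)"
      using j by (simp add: add.commute)
  qed
  finally have int: "(R has_integral sum s {..n} / (real N + 1)) {0..1}" .
  have "sum s {..n} / (real N + 1) \<ge> 0" using has_integral_nonneg[OF int R0] .
  then show ?ge by (simp add: s_def zero_le_divide_iff)
  assume ?eq and j: "j \<le> n"
  then have int0: "(R has_integral 0) (cbox 0 1)" using int by (simp add: s_def)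
  have cont: "continuous_on (cbox 0 1) R" unfolding R_def by (intro continuous_intros)
  \<comment> \<open>A continuous nonnegative function with integral zero vanishes at every point of
    the interval.\<close>
  have R_zero: "R u = 0" if "u \<in> {0..1}" for u
    by (rule has_integral_0_cbox_imp_0[OF cont _ int0]) (use R0 that in auto)
  have "real (N choose j) * s j = 0"
  proof (rule real_coeffs_eq_0[OF _ _ j])
    show "infinite {0::real<..}" by (rule infinite_Ioi)
    fix w :: real assume "w \<in> {0<..}"
    then have w: "w > 0" by simp
    \<comment> \<open>Multiplying by \<open>(1 + w) ^ N\<close> turns the Bernstein form in
      \<open>u\<close> into ordinary powers of \<open>w\<close>, whose coefficients must all
      vanish.\<close>
    define u where "u = w / (1 + w)"
    have u: "u \<in> {0..1}" using w by (simp add: u_def)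
    have u1: "1 - u = 1 / (1 + w)" using w by (simp add: u_def field_simps)
    have "(1 + w) ^ N * R u = (\<Sum>j\<le>n. real (N choose j) * s j * w ^ j)"
      unfolding R_def sum_distrib_left
    proof (intro sum.cong refl)
      fix j assume j: "j \<in> {..n}"
      have "(1 + w) ^ N = (1 + w) ^ j * (1 + w) ^ (N - j)" using j \<open>n \<le> N\<close> by (simp flip: power_add)
      then have eq: "(1 + w) ^ N * (u ^ j * (1 - u) ^ (N - j)) = w ^ j"
        using w unfolding u1 by (simp add: u_def power_divide)
      show "(1 + w) ^ N * (real (N choose j) * s j * (u ^ j * (1 - u) ^ (N - j))) = real (N choose j) * s j * w ^ j"
        unfolding eq[symmetric]
        by (simp only: mult_ac)
    qed
    then show "(\<Sum>j\<le>n. real (N choose j) * s j * w ^ j) = 0" using R_zero[OF u] by simp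
  qed
  then show "e j = 0" using t j \<open>n \<le> N\<close> by (simp add: s_def)
qed

text \<open>Since \<open>K\<close> lies in a hyperplane, the differences of its dilates lie in a
  parallel one. The hitting set is then contained in a product of null sets, with at least one
  factor.\<close>

lemma pvol_hitting_set_lowdim:
  fixes K :: "(real ^ 'n) set"
  assumes K: "compact K" "aff_dim K < int CARD('n)" and "p \<ge> 1"
  shows "pvol p (hitting_set p ((*\<^sub>R) a ` K) ((*\<^sub>R) b ` K)) = 0"
proof -
  obtain h \<beta> where h: "h \<noteq> 0" "K \<subseteq> {x. h \<bullet> x = \<beta>}"
    using aff_lowdim_subset_hyperplane[of K] K(2) by (auto simp: DIM_cart)
  let ?D = "minkowski_add ((*\<^sub>R) b ` K) (-1) ((*\<^sub>R) a ` K)"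
  have D: "compact ?D" using K(1) by (intro compact_minkowski_add compact_scaling)
  have "?D \<subseteq> {x. h \<bullet> x = b * \<beta> - a * \<beta>}"
    using h(2) by (auto simp: minkowski_add_def inner_diff_right) (metis (mono_tags) mem_Collect_eq subsetD)
  then have "negligible ?D" using negligible_hyperplane[of h] h(1) negligible_subset by blast
  then have "emeasure lebesgue ?D = 0" unfolding negligible_iff_null_sets by (rule null_setsD1)
  then have D0: "emeasure lborel ?D = 0" using borel_compact[OF D] by simp
  let ?E = "\<Pi>\<^sub>E i\<in>{..<p}. ?D"
  have E: "?E \<in> sets (lborel_power p)"
    using borel_compact[OF D] by (intro sets_PiM_I_finite) auto
  have "emeasure (lborel_power p) ?E = (\<Prod>i<p. emeasure lborel ?D)"
    using borel_compact[OF D] by (intro lborel_product.emeasure_PiM) auto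
  also have "\<dots> = 0" using assms(3) by (simp add: D0)
  finally have "emeasure (lborel_power p) (hitting_set p ((*\<^sub>R) a ` K) ((*\<^sub>R) b ` K)) = 0"
    using emeasure_mono[OF hitting_set_subset E] by simp
  then show ?thesis by (simp add: pvol_def measure_def)
qed

theorem proposition6p3:
  fixes S :: "(real ^ 'n) set"
  assumes "CARD('n) \<ge> 2"
    and "int CARD('n) simplex S"
    and "\<And>(p::nat) (K :: (real ^ 'n) set) t.
           p \<ge> 1 \<Longrightarrow> convex_body K \<Longrightarrow> aff_dim K = int CARD('n) \<Longrightarrow> t \<in> {0..1} \<Longrightarrow>
           pvol p (diff_body p t K) / measure lborel K ^ p
             \<le> pvol p (diff_body p t S) / measure lborel S ^ p"
    and "\<And>(p::nat) (K :: (real ^ 'n) set) t.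
           p \<ge> 1 \<Longrightarrow> convex_body K \<Longrightarrow> aff_dim K = int CARD('n) \<Longrightarrow> t \<in> {0<..<1} \<Longrightarrow>
           pvol p (diff_body p t K) / measure lborel K ^ p
             = pvol p (diff_body p t S) / measure lborel S ^ p \<Longrightarrow>
           \<exists>k. k simplex K"
  shows "\<forall>p\<ge>1. \<forall>K :: (real ^ 'n) set. convex_body K \<longrightarrow>
           (\<forall>t\<in>{0..1}.
              (\<Sum>j\<le>CARD('n). t ^ j * (1 - t) ^ (CARD('n) - j) * diag_mixed_volume p j K)
                \<le> measure lborel K ^ p) \<and>
           (aff_dim K = int CARD('n) \<and>
            (\<exists>t\<in>{0<..<1}.
              (\<Sum>j\<le>CARD('n). t ^ j * (1 - t) ^ (CARD('n) - j) * diag_mixed_volume p j K)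
                = measure lborel K ^ p)
            \<longrightarrow> (\<exists>k. k simplex K))"
proof (intro allI impI)
  fix p :: nat and K :: "(real ^ 'n) set"
  assume p: "p \<ge> 1" and K: "convex_body K"
  let ?n = "CARD('n)" and ?N = "CARD('n) * p"
  let ?\<kappa> = "measure lborel K" and ?\<sigma> = "measure lborel S"
  have nN: "?n \<le> ?N" using p by simp
  have K': "compact K" "convex K" "K \<noteq> {}" using K by (auto simp: convex_body_def)
  let ?sum = "\<lambda>t. \<Sum>j\<le>?n. t ^ j * (1 - t) ^ (?n - j) * diag_mixed_volume p j K"
  show "(\<forall>t\<in>{0..1}. ?sum t \<le> ?\<kappa> ^ p) \<and>
     (aff_dim K = int ?n \<and> (\<exists>t\<in>{0<..<1}. ?sum t = ?\<kappa> ^ p) \<longrightarrow> (\<exists>k. k simplex K))"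
  proof (cases "aff_dim K = int ?n")
    \<comment> \<open>The hypotheses speak only of full-dimensional bodies. Here all hitting sets
      are null, so every mixed volume vanishes and the left-hand side is zero.\<close>
    case False
    then have "aff_dim K < int ?n" using aff_dim_le_DIM[of K] by (simp add: DIM_cart)
    then have "diag_mixed_volume p j K = 0" if "j \<le> ?n" for j
      using diag_mixed_volume_eq[OF K p that, of "\<lambda>_. 0"] pvol_hitting_set_lowdim[OF K'(1) _ p] by simp
    then show ?thesis using False by simp
  next
    case True
    have \<kappa>: "?\<kappa> > 0"
      using True aff_dim_eq_full[of K] by (intro measure_pos_full_dim K') (simp add: DIM_cart)
    obtain V L l where "barycentric V L l" and S: "S = convex hull V"
      using simplex_barycentric[OF assms(2)] by blast
    then interpret barycentric V L l by simp
    have SS: "convex_body S"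
      using compact_S convex_S V_nonempty by (simp add: convex_body_def S)
    have \<sigma>: "?\<sigma> > 0"
      unfolding S by (rule measure_pos_full_dim[OF compact_S convex_S]) (simp add: affine_hull_V)
    obtain c where c: "\<And>a b. a \<ge> 0 \<Longrightarrow> b \<ge> 0 \<Longrightarrow> pvol p (hitting_set p ((*\<^sub>R) a ` K) ((*\<^sub>R) b ` K)) =
        (\<Sum>j\<le>?n. real (?N choose j) * c j * a ^ j * b ^ (?N - j))"
      using pvol_hitting_set_polynomial[OF K p] by blast
    obtain d where d: "\<And>a b. a \<ge> 0 \<Longrightarrow> b \<ge> 0 \<Longrightarrow> pvol p (hitting_set p ((*\<^sub>R) a ` S) ((*\<^sub>R) b ` S)) =
        (\<Sum>j\<le>?n. real (?N choose j) * d j * a ^ j * b ^ (?N - j))"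
      using pvol_hitting_set_polynomial[OF SS p] by blast
    have dj: "d j = real (?n choose j) * ?\<sigma> ^ p" if "j \<le> ?n" for j
      using dilation_polynomial_coeffs[OF p that, of d] d unfolding S by simp
    have mv: "diag_mixed_volume p j K = c j" if "j \<le> ?n" for j
      using diag_mixed_volume_eq[OF K p that c] by simp
    define e where "e j = real (?n choose j) * ?\<kappa> ^ p - c j" for j
    have volS: "pvol p (diff_body p t S) / ?\<sigma> ^ p = (\<Sum>j\<le>?n. real (?N choose j) * real (?n choose j) * t ^ j * (1 - t) ^ (?N - j))"
      if "t \<in> {0..1}" for t
      using that \<sigma> by (simp add: diff_body_eq_hitting_set d dj sum_divide_distrib mult.assoc)
    have volK: "pvol p (diff_body p t K) / ?\<kappa> ^ p = (\<Sum>j\<le>?n. real (?N choose j) * c j * t ^ j * (1 - t) ^ (?N - j)) / ?\<kappa> ^ p"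
      if "t \<in> {0..1}" for t
      using that by (simp add: diff_body_eq_hitting_set c)
    \<comment> \<open>The weighted sum of the \<open>e j\<close> is the gap in the hypothesis at the
      same \<open>t\<close>, multiplied by a positive number.\<close>
    have diff: "(\<Sum>j\<le>?n. real (?N choose j) * e j * t ^ j * (1 - t) ^ (?N - j)) =
        ?\<kappa> ^ p * (pvol p (diff_body p t S) / ?\<sigma> ^ p - pvol p (diff_body p t K) / ?\<kappa> ^ p)" if "t \<in> {0..1}" for t
    proof -
      have cancel: "?\<kappa> ^ p * (x - y / ?\<kappa> ^ p) = ?\<kappa> ^ p * x - y" for x y using \<kappa> by (simp add: right_diff_distrib)
      show ?thesis
        unfolding volS[OF that] volK[OF that] cancel e_def
        by (simp only: right_diff_distrib left_diff_distrib sum_subtractf sum_distrib_left mult_ac)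
    qed
    have nonneg: "(\<Sum>j\<le>?n. real (?N choose j) * e j * t ^ j * (1 - t) ^ (?N - j)) \<ge> 0" if "t \<in> {0..1}" for t
      unfolding diff[OF that] using assms(3)[OF p K True that] \<kappa> by simp
    have sum: "?\<kappa> ^ p - ?sum t = (\<Sum>j\<le>?n. e j * t ^ j * (1 - t) ^ (?n - j))" for t
    proof -
      have "(\<Sum>j\<le>?n. real (?n choose j) * t ^ j * (1 - t) ^ (?n - j)) = (t + (1 - t)) ^ ?n"
        by (simp only: binomial_ring)
      then have "?\<kappa> ^ p = (\<Sum>j\<le>?n. real (?n choose j) * t ^ j * (1 - t) ^ (?n - j)) * ?\<kappa> ^ p" by simp
      moreover have "?sum t = (\<Sum>j\<le>?n. t ^ j * (1 - t) ^ (?n - j) * c j)"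
        by (intro sum.cong) (simp_all add: mv)
      moreover have "(\<Sum>j\<le>?n. e j * t ^ j * (1 - t) ^ (?n - j)) =
          (\<Sum>j\<le>?n. real (?n choose j) * t ^ j * (1 - t) ^ (?n - j)) * ?\<kappa> ^ p - (\<Sum>j\<le>?n. t ^ j * (1 - t) ^ (?n - j) * c j)"
        by (simp only: e_def left_diff_distrib sum_subtractf sum_distrib_right) (simp only: mult_ac)
      ultimately show ?thesis by linarith
    qed
    \<comment> \<open>The averaging works for \<open>t\<close> in the open interval only; the
      endpoints follow by continuity.\<close>
    have "?sum t \<le> ?\<kappa> ^ p" if "t \<in> {0..1}" for t
    proof -
      let ?f = "\<lambda>t. \<Sum>j\<le>?n. e j * t ^ j * (1 - t) ^ (?n - j)"
      have "0 \<le> ?f t"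
      proof (rule continuous_ge_on_closure[of "{0<..<1}" ?f])
        show "continuous_on (closure {0<..<1}) ?f" by (intro continuous_intros)
        show "t \<in> closure {0<..<1}" using that by simp
      qed (rule binomial_weights_removal(1)[OF nonneg nN])
      then show ?thesis using sum[of t] by linarith
    qed
    moreover have "\<exists>k. k simplex K" if t: "t \<in> {0<..<1}" and eq: "?sum t = ?\<kappa> ^ p" for t
    proof -
      \<comment> \<open>Equality at one \<open>t\<close> removes the gap for every \<open>t\<close>,
        in particular for this one, where the equality hypothesis applies.\<close>
      have "e j = 0" if "j \<le> ?n" for j
        using binomial_weights_removal(2)[OF nonneg nN t _ that] sum[of t] eq by simp
      then have "pvol p (diff_body p t K) / ?\<kappa> ^ p = pvol p (diff_body p t S) / ?\<sigma> ^ p"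
        using diff[of t] t \<kappa> by simp
      then show ?thesis by (rule assms(4)[OF p K True t])
    qed
    ultimately show ?thesis by blast
  qed
qed

end
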